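(* Let $E$ be an order continuous Banach lattice with a weak unit, represented over a probability space $(\Omega,\Sigma,\mu)$ with inclusion $j:E\to L_1(\mu)$, let $Y$ be a Banach space and $T\in\mathrm{DN\text{-}S}(E,Y)$, and let $\overline{T}:L_1(\mu)\to\mathrm{PO}$ be the push-out operator described in the context. Then: (1) $\overline{T}\in\mathrm{DN\text{-}S}(L_1(\mu),\mathrm{PO})$ (equivalently, $\overline{T}$ is tauberian); (2) $T$ is tauberian; (3) $T^{**}$ is tauberian and the operator $T^{co}:E^{**}/E\to Y^{**}/Y$ induced by $T^{**}$ is an isomorphism into.
   Context: A Banach lattice $E$ is order continuous if every net decreasing in order to $0$ converges in norm to $0$; $e\in E_+$ is a weak unit if $|x|\wedge e=0$ implies $x=0$. Representation: such $E$ can be represented over a probability space $(\Omega,\Sigma,\mu)$ so that $L_\infty(\mu)\subset E\subset L_1(\mu)$, $E$ dense in $L_1(\mu)$, $L_\infty(\mu)$ dense in $E$, $\|f\|_1\le\|f\|_E\le2\|f\|_\infty$ on $L_\infty(\mu)$, and the order of $E$ is induced by $L_1(\mu)$; $j:E\to L_1(\mu)$ is the (bounded) inclusion. Push-out: let $\Delta=\{(Tx,-jx):x\in E\}\subset Y\oplus_1 L_1(\mu)$ (norm $\|(y,f)\|=\|y\|+\|f\|_1$), $\overline{\Delta}$ its closure, $\mathrm{PO}=(Y\oplus_1L_1(\mu))/\overline{\Delta}$, and $\overline{T}:L_1(\mu)\to\mathrm{PO}$, $\overline{T}f=(0,f)+\overline{\Delta}$. An operator is strictly singular if it is an isomorphism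 on no closed infinite-dimensional subspace. $T$ is disjointly non-singular ($\mathrm{DN\text{-}S}$) if there is no disjoint sequence $(x_n)$ of non-zero vectors such that $T$ restricted to the closed span $[x_n]$ is strictly singular. An operator $S:X\to Z$ between Banach spaces is tauberian if $(S^{**})^{-1}(Z)=X$ (viewing $X\subset X^{**}$, $Z\subset Z^{**}$ canonically); $S^{co}:X^{**}/X\to Z^{**}/Z$ is the operator $x^{**}+X\mapsto S^{**}x^{**}+Z$. *)

theory Defs
  imports "HOL-Probability.Probability"
begin

definition labs :: "'a::{ordered_real_vector,lattice} \<Rightarrow> 'a" where
  "labs x = sup x (- x)"

definition banach_lattice :: "'a::{banach,ordered_real_vector,lattice} itself \<Rightarrow> bool" where
  "banach_lattice _ = (\<forall>x y::'a. labs x \<le> labs y \<longrightarrow> norm x \<le> norm y)"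

text \<open>Order continuity: every net decreasing in order to 0 converges in norm to 0.
  A decreasing net is encoded by its (downward directed) set of values D, indexed by
  D itself with the reversed order; "decreasing to 0" means 0 is the infimum of D.\<close>
definition order_continuous :: "'a::{banach,ordered_real_vector,lattice} itself \<Rightarrow> bool" where
  "order_continuous _ = (\<forall>D::'a set.
      D \<noteq> {} \<and> (\<forall>x\<in>D. \<forall>y\<in>D. \<exists>z\<in>D. z \<le> x \<and> z \<le> y)
      \<and> (\<forall>x\<in>D. 0 \<le> x) \<and> (\<forall>l. (\<forall>x\<in>D. l \<le> x) \<longrightarrow> l \<le> 0)
      \<longrightarrow> (\<forall>\<epsilon>>0. \<exists>x0\<in>D. \<forall>z\<in>D. z \<le> x0 \<longrightarrow> norm z < \<epsilon>))"

definition weak_unit :: "'a::{banach,ordered_real_vector,lattice} \<Rightarrow> bool" where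
  "weak_unit e = (0 \<le> e \<and> (\<forall>x. inf (labs x) e = 0 \<longrightarrow> x = 0))"

definition ess_bounded :: "'w measure \<Rightarrow> ('w \<Rightarrow> real) \<Rightarrow> bool" where
  "ess_bounded M f = (\<exists>C. AE \<omega> in M. \<bar>f \<omega>\<bar> \<le> C)"

definition L1_norm :: "'w measure \<Rightarrow> ('w \<Rightarrow> real) \<Rightarrow> real" where
  "L1_norm M f = (\<integral>\<omega>. \<bar>f \<omega>\<bar> \<partial>M)"

definition L1_representation ::
  "'w measure \<Rightarrow> ('a::{banach,ordered_real_vector,lattice} \<Rightarrow> 'w \<Rightarrow> real) \<Rightarrow> bool" where
  "L1_representation M j =
    (prob_space M
     \<and> (\<forall>x. integrable M (j x))
     \<and> (\<forall>x y. AE \<omega> in M. j (x + y) \<omega> = j x \<omega> + j y \<omega>)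
     \<and> (\<forall>c x. AE \<omega> in M. j (c *\<^sub>R x) \<omega> = c * j x \<omega>)
     \<and> (\<forall>x y. x \<le> y \<longleftrightarrow> (AE \<omega> in M. j x \<omega> \<le> j y \<omega>))
     \<and> (\<exists>K. \<forall>x. L1_norm M (j x) \<le> K * norm x)
     \<and> (\<forall>f \<in> borel_measurable M. ess_bounded M f \<longrightarrow> (\<exists>x. AE \<omega> in M. j x \<omega> = f \<omega>))
     \<and> (\<forall>f. integrable M f \<longrightarrow> (\<forall>\<epsilon>>0. \<exists>x. L1_norm M (\<lambda>\<omega>. f \<omega> - j x \<omega>) < \<epsilon>))
     \<and> (\<forall>x. \<forall>\<epsilon>>0. \<exists>x'. ess_bounded M (j x') \<and> norm (x - x') < \<epsilon>)
     \<and> (\<forall>x C. (AE \<omega> in M. \<bar>j x \<omega>\<bar> \<le> C) \<longrightarrow> L1_norm M (j x) \<le> norm x \<and> norm x \<le> 2 * C))"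

definition bounded_below_on :: "('a::real_normed_vector \<Rightarrow> 'b::real_normed_vector) \<Rightarrow> 'a set \<Rightarrow> bool" where
  "bounded_below_on T Z = (\<exists>c>0. \<forall>z\<in>Z. c * norm z \<le> norm (T z))"

definition strictly_singular_on :: "('a::real_normed_vector \<Rightarrow> 'b::real_normed_vector) \<Rightarrow> 'a set \<Rightarrow> bool" where
  "strictly_singular_on T W = (\<forall>Z. subspace Z \<and> closed Z \<and> Z \<subseteq> W
        \<and> \<not> (\<exists>B. finite B \<and> Z \<subseteq> span B) \<longrightarrow> \<not> bounded_below_on T Z)"

definition disjoint_seq :: "(nat \<Rightarrow> 'a::{ordered_real_vector,lattice}) \<Rightarrow> bool" where
  "disjoint_seq x = (\<forall>n m. n \<noteq> m \<longrightarrow> inf (labs (x n)) (labs (x m)) = 0)"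

definition DNS :: "('a::{banach,ordered_real_vector,lattice} \<Rightarrow>\<^sub>L 'b::banach) \<Rightarrow> bool" where
  "DNS T = (\<not> (\<exists>x. (\<forall>n. x n \<noteq> 0) \<and> disjoint_seq x
                 \<and> strictly_singular_on (blinfun_apply T) (closure (span (range x)))))"

definition bidual_emb :: "'a::real_normed_vector \<Rightarrow> (('a \<Rightarrow>\<^sub>L real) \<Rightarrow>\<^sub>L real)" where
  "bidual_emb x = Blinfun (\<lambda>f. blinfun_apply f x)"

definition bidual_op :: "('a::real_normed_vector \<Rightarrow>\<^sub>L 'b::real_normed_vector)
    \<Rightarrow> (('a \<Rightarrow>\<^sub>L real) \<Rightarrow>\<^sub>L real) \<Rightarrow>\<^sub>L (('b \<Rightarrow>\<^sub>L real) \<Rightarrow>\<^sub>L real)" where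
  "bidual_op T = Blinfun (\<lambda>\<phi>. Blinfun (\<lambda>g. blinfun_apply \<phi> (g o\<^sub>L T)))"

definition tauberian :: "('a::real_normed_vector \<Rightarrow>\<^sub>L 'b::real_normed_vector) \<Rightarrow> bool" where
  "tauberian T = (\<forall>\<phi>. bidual_op T \<phi> \<in> range bidual_emb \<longrightarrow> \<phi> \<in> range bidual_emb)"

text \<open>T^co : X**/X -> Y**/Y is an isomorphism into (injective with closed range), i.e. bounded
  below for the quotient norms, which are the distances to the closed subspaces X, Y.\<close>
definition Tco_isomorphism_into :: "('a::real_normed_vector \<Rightarrow>\<^sub>L 'b::real_normed_vector) \<Rightarrow> bool" where
  "Tco_isomorphism_into T = (\<exists>c>0. \<forall>\<phi>.
      c * infdist \<phi> (range bidual_emb) \<le> infdist (bidual_op T \<phi>) (range bidual_emb))"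

definition L1 :: "'w measure \<Rightarrow> ('w \<Rightarrow> real) set" where
  "L1 M = {f. integrable M f}"

text \<open>Norm in PO of Tbar f = (0,f) + closure Delta: the quotient norm, i.e. the distance of (0,f)
  to Delta (= distance to its closure) in Y \<oplus>_1 L_1.\<close>
definition pushout_norm :: "('a::real_normed_vector \<Rightarrow>\<^sub>L 'b::real_normed_vector) \<Rightarrow> ('a \<Rightarrow> 'w \<Rightarrow> real)
    \<Rightarrow> 'w measure \<Rightarrow> ('w \<Rightarrow> real) \<Rightarrow> real" where
  "pushout_norm T j M f = (INF x. norm (T x) + L1_norm M (\<lambda>\<omega>. f \<omega> - j x \<omega>))"

definition L1_closed_span :: "'w measure \<Rightarrow> (nat \<Rightarrow> 'w \<Rightarrow> real) \<Rightarrow> ('w \<Rightarrow> real) set" where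
  "L1_closed_span M F = {g \<in> L1 M. \<forall>\<epsilon>>0. \<exists>n c.
       L1_norm M (\<lambda>\<omega>. g \<omega> - (\<Sum>i<n. c i * F i \<omega>)) < \<epsilon>}"

definition L1_closed_subspace :: "'w measure \<Rightarrow> ('w \<Rightarrow> real) set \<Rightarrow> bool" where
  "L1_closed_subspace M Z = (Z \<subseteq> L1 M \<and> (\<lambda>_. 0) \<in> Z
      \<and> (\<forall>f\<in>Z. \<forall>g\<in>Z. (\<lambda>\<omega>. f \<omega> + g \<omega>) \<in> Z)
      \<and> (\<forall>c. \<forall>f\<in>Z. (\<lambda>\<omega>. c * f \<omega>) \<in> Z)
      \<and> (\<forall>g\<in>L1 M. (\<forall>\<epsilon>>0. \<exists>h\<in>Z. L1_norm M (\<lambda>\<omega>. g \<omega> - h \<omega>) < \<epsilon>) \<longrightarrow> g \<in> Z))"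

definition L1_infinite_dim :: "'w measure \<Rightarrow> ('w \<Rightarrow> real) set \<Rightarrow> bool" where
  "L1_infinite_dim M Z = (\<forall>n::nat. \<exists>F. (\<forall>i<n. F i \<in> Z)
      \<and> (\<forall>c. (AE \<omega> in M. (\<Sum>i<n. c i * F i \<omega>) = 0) \<longrightarrow> (\<forall>i<n. c i = 0)))"

text \<open>S strictly singular on W, where N f = norm of S f (S defined on L_1).\<close>
definition L1_strictly_singular_on :: "'w measure \<Rightarrow> (('w \<Rightarrow> real) \<Rightarrow> real) \<Rightarrow> ('w \<Rightarrow> real) set \<Rightarrow> bool" where
  "L1_strictly_singular_on M N W = (\<forall>Z. L1_closed_subspace M Z \<and> Z \<subseteq> W \<and> L1_infinite_dim M Z
      \<longrightarrow> \<not> (\<exists>c>0. \<forall>f\<in>Z. c * L1_norm M f \<le> N f))"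

definition L1_DNS :: "'w measure \<Rightarrow> (('w \<Rightarrow> real) \<Rightarrow> real) \<Rightarrow> bool" where
  "L1_DNS M N = (\<not> (\<exists>F. (\<forall>n. F n \<in> L1 M \<and> \<not> (AE \<omega> in M. F n \<omega> = 0))
      \<and> (\<forall>n m. n \<noteq> m \<longrightarrow> (AE \<omega> in M. F n \<omega> = 0 \<or> F m \<omega> = 0))
      \<and> L1_strictly_singular_on M N (L1_closed_span M F)))"

end

theory Submission
  imports Defs
begin

text \<open>
  Everything rests on one estimate: if \<open>T\<close> is disjointly non-singular, there are \<open>r, \<delta> > 0\<close> such that
  \<open>r \<parallel>x\<parallel> \<le> \<parallel>T x\<parallel>\<close> whenever \<open>\<mu>(|j x| > \<delta> \<parallel>x\<parallel>) < \<delta>\<close>. Otherwise some normalised sequence tends to zero in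
  measure and along \<open>T\<close>; by order continuity a gliding hump argument replaces it by a disjoint sequence
  \<open>(y\<^sub>k)\<close> with \<open>\<Sum> \<parallel>T y\<^sub>k\<parallel> < \<infinity>\<close>, and \<open>T\<close> is strictly singular on the closed span of \<open>(y\<^sub>k)\<close>.

  For the push-out, functions in the tails of the closed span of a disjoint sequence of \<open>L\<^sub>1\<close> are small in
  measure, and so are elements of \<open>E\<close> that are \<open>L\<^sub>1\<close>-close to them.

  For \<open>T^co\<close>, let \<open>\<parallel>T**\<phi> - y\<parallel> < d\<close>. By Helly's theorem every weak* neighbourhood of \<open>\<phi>\<close> meets the bounded
  convex set \<open>{x. \<parallel>x\<parallel> \<le> \<parallel>\<phi>\<parallel> \<and> \<parallel>T x - y\<parallel> < d}\<close>. Near-minimisers of the strictly convex functional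
  \<open>\<integral> sqrt (1 + (j x)\<^sup>2) d\<mu>\<close> on small neighbourhoods are close to each other in measure, so the estimate puts them
  within \<open>2 d / r\<close> of each other, and hence \<open>\<phi>\<close> within \<open>2 d / r\<close> of \<open>E\<close>. That \<open>T\<close> and \<open>T**\<close> are tauberian
  follows by duality.
\<close>

section \<open>Hahn--Banach and biduals\<close>

text \<open>Homogeneity is asked for as an inequality, including \<open>c = 0\<close>;
  \<open>sublinear_scaleR\<close> recovers equality by scaling back with
  \<open>inverse c\<close>.\<close>

definition sublinear :: "('v::real_vector \<Rightarrow> real) \<Rightarrow> bool" where
  "sublinear p \<longleftrightarrow> (\<forall>u v. p (u + v) \<le> p u + p v) \<and> (\<forall>c\<ge>0. \<forall>u. p (c *\<^sub>R u) \<le> c * p u)"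

lemma sublinear_add: "sublinear p \<Longrightarrow> p (u + v) \<le> p u + p v"
  by (simp add: sublinear_def)

lemma sublinear_scaleR_le: "sublinear p \<Longrightarrow> 0 \<le> c \<Longrightarrow> p (c *\<^sub>R u) \<le> c * p u"
  by (simp add: sublinear_def)

lemma sublinear_zero: "sublinear p \<Longrightarrow> p 0 = 0"
  using sublinear_add[of p 0 0] sublinear_scaleR_le[of p 0 0] by simp

lemma sublinear_minus: "sublinear p \<Longrightarrow> 0 \<le> p u + p (- u)"
  using sublinear_add[of p u "-u"] by (simp add: sublinear_zero)

lemma sublinear_scaleR:
  assumes "sublinear p" "0 \<le> c"
  shows "p (c *\<^sub>R u) = c * p u"
proof (cases "c = 0")
  case True
  then show ?thesis using assms by (simp add: sublinear_zero)
next
  case False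
  have "p (inverse c *\<^sub>R (c *\<^sub>R u)) \<le> inverse c * p (c *\<^sub>R u)"
    using assms by (intro sublinear_scaleR_le) auto
  then have "c * p u \<le> p (c *\<^sub>R u)"
    using False assms(2) by (simp add: field_simps)
  then show ?thesis using sublinear_scaleR_le[OF assms, of u] by simp
qed

text \<open>The cone \<open>A\<close> encodes one-sided constraints. The infimal convolution of
  \<open>p\<close> with them is sublinear because \<open>A\<close> is closed under sums and
  nonnegative multiples, and \<open>bound\<close> keeps it finite: every term is at least
  \<open>- p (- u)\<close>.\<close>

lemma sublinear_inf_convolution:
  fixes p :: "'v::real_vector \<Rightarrow> real" and A :: "('v \<times> real) set"
  assumes p: "sublinear p"
    and A0: "(0, 0) \<in> A"
    and Aadd: "\<And>a b. a \<in> A \<Longrightarrow> b \<in> A \<Longrightarrow> a + b \<in> A"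
    and Ascale: "\<And>c a. 0 \<le> c \<Longrightarrow> a \<in> A \<Longrightarrow> c *\<^sub>R a \<in> A"
    and bound: "\<And>v s. (v, s) \<in> A \<Longrightarrow> 0 \<le> p (- v) + s"
  shows "\<exists>q. sublinear q \<and> q \<le> p \<and> (\<forall>(v, s) \<in> A. q v \<le> s)"
proof -
  define q where "q u = (INF a\<in>A. p (u - fst a) + snd a)" for u
  have bdd: "bdd_below ((\<lambda>a. p (u - fst a) + snd a) ` A)" for u
  proof (rule bdd_belowI2)
    fix a assume "a \<in> A"
    then have "0 \<le> p (- fst a) + snd a" using bound[of "fst a" "snd a"] by simp
    moreover have "p (- fst a) \<le> p (u - fst a) + p (- u)"
      using sublinear_add[OF p, of "u - fst a" "- u"] by simp
    ultimately show "- p (- u) \<le> p (u - fst a) + snd a" by simp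
  qed
  have q_le: "q u \<le> p (u - fst a) + snd a" if "a \<in> A" for u a
    unfolding q_def by (rule cINF_lower[OF bdd that])
  have q_near: "\<exists>a\<in>A. p (u - fst a) + snd a < q u + e" if "e > 0" for u e
    using cINF_less_iff[OF _ bdd, of u "q u + e"] A0 that unfolding q_def by auto
  have "q (u + v) \<le> q u + q v" for u v
  proof (rule field_le_epsilon)
    fix e :: real assume "e > 0"
    then obtain a b where ab: "a \<in> A" "p (u - fst a) + snd a < q u + e/2"
        "b \<in> A" "p (v - fst b) + snd b < q v + e/2"
      using q_near[of "e/2" u] q_near[of "e/2" v] by auto
    have "q (u + v) \<le> p ((u - fst a) + (v - fst b)) + (snd a + snd b)"
      using q_le[OF Aadd[OF ab(1,3)], of "u + v"] by (simp add: algebra_simps)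
    also have "\<dots> \<le> p (u - fst a) + p (v - fst b) + (snd a + snd b)"
      using sublinear_add[OF p] by simp
    finally show "q (u + v) \<le> q u + q v + e" using ab by linarith
  qed
  moreover have "q (c *\<^sub>R u) \<le> c * q u" if c: "c \<ge> 0" for c u
  proof (rule field_le_epsilon)
    fix e :: real assume e: "e > 0"
    \<comment> \<open>The denominator \<open>c + 1\<close> covers \<open>c = 0\<close> and still
      gives \<open>c * e / (c + 1) \<le> e\<close>.\<close>
    obtain a where a: "a \<in> A" "p (u - fst a) + snd a < q u + e/(c+1)"
      using q_near[of "e/(c+1)" u] e c by auto
    have "q (c *\<^sub>R u) \<le> p (c *\<^sub>R (u - fst a)) + c * snd a"
      using q_le[OF Ascale[OF c a(1)], of "c *\<^sub>R u"] by (simp add: algebra_simps)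
    also have "\<dots> = c * (p (u - fst a) + snd a)"
      by (simp add: sublinear_scaleR[OF p c] distrib_left)
    also have "\<dots> \<le> c * (q u + e/(c+1))" using a c by (intro mult_left_mono) auto
    also have "\<dots> \<le> c * q u + e" using c e by (simp add: field_simps)
    finally show "q (c *\<^sub>R u) \<le> c * q u + e" .
  qed
  moreover have "q \<le> p" using q_le[OF A0] by (auto simp: le_fun_def)
  moreover have "q v \<le> s" if "(v, s) \<in> A" for v s
    using q_le[OF that, of v] sublinear_zero[OF p] by simp
  ultimately show ?thesis by (intro exI[of _ q]) (auto simp: sublinear_def)
qed

text \<open>A minimal sublinear functional is linear, so Zorn's lemma replaces the usual extension of
  functionals from subspaces.\<close>
theorem dominated_linear_functional:
  fixes p :: "'v::real_vector \<Rightarrow> real"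
  assumes p: "sublinear p"
  shows "\<exists>g. linear g \<and> (\<forall>u. g u \<le> p u)"
proof -
  define S where "S = {q. sublinear q \<and> q \<le> p}"
  \<comment> \<open>The order is reversed, so a maximal element for \<open>P\<close> is a minimal
    sublinear functional below \<open>p\<close>.\<close>
  define P where "P = (\<lambda>f g :: 'v \<Rightarrow> real. g \<le> f)"
  have "\<exists>m\<in>S. \<forall>a\<in>S. P m a \<longrightarrow> a = m"
  proof (rule predicate_Zorn)
    show "partial_order_on S (relation_of P S)"
      by (rule partial_order_on_relation_ofI) (auto simp: P_def)
  next
    fix C assume "C \<in> Chains (relation_of P S)"
    then have CS: "C \<subseteq> S" and chain: "\<And>f g. f \<in> C \<Longrightarrow> g \<in> C \<Longrightarrow> f \<le> g \<or> g \<le> f"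
      by (auto simp: Chains_def relation_of_def P_def)
    show "\<exists>u\<in>S. \<forall>a\<in>C. P a u"
    proof (cases "C = {}")
      case True
      then show ?thesis using p by (auto simp: S_def)
    next
      case False
      define q where "q u = (INF f\<in>C. f u)" for u
      have bdd: "bdd_below ((\<lambda>f. f u) ` C)" for u
      proof (rule bdd_belowI2)
        fix f assume "f \<in> C"
        then have "sublinear f" "f (- u) \<le> p (- u)" using CS by (auto simp: S_def le_fun_def)
        then show "- p (- u) \<le> f u" using sublinear_minus[of f u] by simp
      qed
      have q_le: "q u \<le> f u" if "f \<in> C" for u f
        unfolding q_def by (rule cINF_lower[OF bdd that])
      have q_near: "\<exists>f\<in>C. f u < q u + e" if "e > 0" for u e
        using cINF_less_iff[OF False bdd, of u "q u + e"] that unfolding q_def by auto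
      have "q (u + v) \<le> q u + q v" for u v
      proof (rule field_le_epsilon)
        fix e :: real assume "e > 0"
        then obtain f g where fg: "f \<in> C" "f u < q u + e/2" "g \<in> C" "g v < q v + e/2"
          using q_near[of "e/2" u] q_near[of "e/2" v] by auto
        obtain h where h: "h \<in> C" "h \<le> f" "h \<le> g" using chain[OF fg(1,3)] fg by auto
        have "q (u + v) \<le> h (u + v)" by (rule q_le[OF h(1)])
        also have "\<dots> \<le> h u + h v" using h CS by (intro sublinear_add) (auto simp: S_def)
        also have "\<dots> \<le> f u + g v" using h by (intro add_mono) (auto simp: le_fun_def)
        finally show "q (u + v) \<le> q u + q v + e" using fg by linarith
      qed
      moreover have "q (c *\<^sub>R u) \<le> c * q u" if c: "c \<ge> 0" for c u
      proof (rule field_le_epsilon)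
        fix e :: real assume e: "e > 0"
        obtain f where f: "f \<in> C" "f u < q u + e/(c+1)"
          using q_near[of "e/(c+1)" u] e c by auto
        have "q (c *\<^sub>R u) \<le> f (c *\<^sub>R u)" by (rule q_le[OF f(1)])
        also have "\<dots> \<le> c * f u" using f CS c by (intro sublinear_scaleR_le) (auto simp: S_def)
        also have "\<dots> \<le> c * (q u + e/(c+1))" using f c by (intro mult_left_mono) auto
        also have "\<dots> \<le> c * q u + e" using c e by (simp add: field_simps)
        finally show "q (c *\<^sub>R u) \<le> c * q u + e" .
      qed
      moreover have "q \<le> p"
      proof -
        obtain f where "f \<in> C" using False by auto
        then have "q \<le> f" "f \<le> p" using q_le CS by (auto simp: le_fun_def S_def)
        then show ?thesis by simp
      qed
      ultimately have "q \<in> S" by (auto simp: S_def sublinear_def)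
      then show ?thesis using q_le by (auto simp: P_def le_fun_def)
    qed
  qed
  then obtain m where m: "sublinear m" "m \<le> p" and min: "\<And>a. sublinear a \<Longrightarrow> a \<le> m \<Longrightarrow> a = m"
    unfolding S_def P_def by auto
  have superadd: "m u + m x \<le> m (u + x)" for u x
  proof -
    \<comment> \<open>Convolving \<open>m\<close> with this ray yields a sublinear functional below
      \<open>m\<close> that is at most \<open>- m x\<close> at \<open>- x\<close>. By minimality it
      is \<open>m\<close> itself, so \<open>m (- x) \<le> - m x\<close>.\<close>
    let ?A = "{(- (t *\<^sub>R x), - (t * m x)) | t. 0 \<le> t}"
    have "\<exists>q. sublinear q \<and> q \<le> m \<and> (\<forall>(v, s) \<in> ?A. q v \<le> s)"
    proof (rule sublinear_inf_convolution[OF m(1)])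
      show "a + b \<in> ?A" if ab: "a \<in> ?A" "b \<in> ?A" for a b
      proof -
        obtain s t where "a = (- (s *\<^sub>R x), - (s * m x))" "s \<ge> 0" "b = (- (t *\<^sub>R x), - (t * m x))" "t \<ge> 0"
          using ab by blast
        then show ?thesis by (auto intro!: exI[of _ "s + t"] simp: algebra_simps)
      qed
      show "c *\<^sub>R a \<in> ?A" if ca: "0 \<le> c" "a \<in> ?A" for c a
      proof -
        obtain s where "a = (- (s *\<^sub>R x), - (s * m x))" "s \<ge> 0" using ca by blast
        then show ?thesis using ca(1) by (auto intro!: exI[of _ "c * s"])
      qed
      show "(0, 0) \<in> ?A" by (auto intro!: exI[of _ 0])
    qed (use sublinear_scaleR[OF m(1)] in auto)
    then obtain q where q: "sublinear q" "q \<le> m" "\<forall>(v, s) \<in> ?A. q v \<le> s" by blast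
    have "(- x, - m x) \<in> ?A" by (auto intro!: exI[of _ 1])
    then have "m (- x) \<le> - m x" using min[OF q(1,2)] q(3) by blast
    moreover have "m u \<le> m (u + x) + m (- x)" using sublinear_add[OF m(1), of "u + x" "- x"] by simp
    ultimately show ?thesis by simp
  qed
  have add: "m (u + v) = m u + m v" for u v
    using superadd[of u v] sublinear_add[OF m(1), of u v] by simp
  have neg: "m (- u) = - m u" for u
    using add[of u "- u"] sublinear_zero[OF m(1)] by simp
  have "m (c *\<^sub>R u) = c * m u" for c u
    using sublinear_scaleR[OF m(1), of c u] sublinear_scaleR[OF m(1), of "- c" u] neg[of "c *\<^sub>R u"]
    by (cases "c \<ge> 0") auto
  then have "linear m" by (intro linearI) (auto simp: add)
  then show ?thesis using m(2) by (auto simp: le_fun_def)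
qed

text \<open>Hahn-Banach with the dominating functional \<open>C * norm u\<close>. A cone generated
  by a convex set gives separation; a linear subspace of pairs turns the inequalities into
  equalities and so gives extension.\<close>

lemma bounded_functional_below_cone:
  fixes A :: "('v::real_normed_vector \<times> real) set"
  assumes C: "0 \<le> C"
    and A0: "(0, 0) \<in> A"
    and Aadd: "\<And>a b. a \<in> A \<Longrightarrow> b \<in> A \<Longrightarrow> a + b \<in> A"
    and Ascale: "\<And>c a. 0 \<le> c \<Longrightarrow> a \<in> A \<Longrightarrow> c *\<^sub>R a \<in> A"
    and bound: "\<And>v s. (v, s) \<in> A \<Longrightarrow> 0 \<le> C * norm v + s"
  shows "\<exists>g :: 'v \<Rightarrow>\<^sub>L real. norm g \<le> C \<and> (\<forall>(v, s) \<in> A. blinfun_apply g v \<le> s)"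
proof -
  have "sublinear (\<lambda>u::'v. C * norm u)"
    using C by (auto simp: sublinear_def distrib_left[symmetric] intro!: mult_left_mono norm_triangle_ineq)
  then have "\<exists>q. sublinear q \<and> q \<le> (\<lambda>u. C * norm u) \<and> (\<forall>(v, s) \<in> A. q v \<le> s)"
    by (rule sublinear_inf_convolution[OF _ A0 Aadd Ascale]) (use bound in auto)
  then obtain q where q: "sublinear q" "q \<le> (\<lambda>u. C * norm u)" "\<forall>(v, s) \<in> A. q v \<le> s"
    by blast
  obtain g where g: "linear g" "\<And>u. g u \<le> q u" using dominated_linear_functional[OF q(1)] by blast
  have le: "g u \<le> C * norm u" for u using g(2)[of u] q(2) by (auto simp: le_fun_def intro: order.trans)
  have bd: "norm (g u) \<le> norm u * C" for u
    using le[of u] le[of "- u"] by (simp add: linear_neg[OF g(1)] abs_le_iff mult.commute)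
  have bl: "bounded_linear g"
    using g(1) bd by (intro bounded_linear_intro) (auto simp: linear_add linear_scale)
  have "norm (Blinfun g) \<le> C"
    by (rule norm_blinfun_bound[OF C]) (use bd in \<open>simp add: bounded_linear_Blinfun_apply[OF bl] mult.commute\<close>)
  moreover have "\<forall>(v, s) \<in> A. blinfun_apply (Blinfun g) v \<le> s"
    using q(3) order.trans[OF g(2)] by (fastforce simp: bounded_linear_Blinfun_apply[OF bl])
  ultimately show ?thesis by blast
qed

text \<open>On the cone generated by the pairs \<open>(- c, - d)\<close> with \<open>c\<close> in
  \<open>D\<close> the constraint reads \<open>d \<le> g c\<close>, and the required bound is
  \<open>t * d \<le> t * norm c\<close>.\<close>

lemma functional_separating_convex_from_zero:
  fixes D :: "'v::real_normed_vector set"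
  assumes D: "convex D" and dist: "\<And>c. c \<in> D \<Longrightarrow> d \<le> norm c"
  shows "\<exists>g :: 'v \<Rightarrow>\<^sub>L real. norm g \<le> 1 \<and> (\<forall>c\<in>D. d \<le> blinfun_apply g c)"
proof (cases "D = {}")
  case True
  then show ?thesis by (auto intro!: exI[of _ 0])
next
  case False
  let ?A = "{(- (t *\<^sub>R c), - (t * d)) | t c. 0 \<le> t \<and> c \<in> D}"
  have "\<exists>g :: 'v \<Rightarrow>\<^sub>L real. norm g \<le> 1 \<and> (\<forall>(v, s) \<in> ?A. blinfun_apply g v \<le> s)"
  proof (rule bounded_functional_below_cone)
    show "(0, 0) \<in> ?A" using False by auto
    show "a + b \<in> ?A" if ab: "a \<in> ?A" "b \<in> ?A" for a b
    proof -
      obtain s x t y where st: "a = (- (s *\<^sub>R x), - (s * d))" "s \<ge> 0" "x \<in> D"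
          "b = (- (t *\<^sub>R y), - (t * d))" "t \<ge> 0" "y \<in> D"
        using ab by blast
      show ?thesis
      proof (cases "s + t = 0")
        case True
        then have "s = 0" "t = 0" using st by auto
        then show ?thesis using st by auto
      next
        case False
        \<comment> \<open>The sum of two points of the cone is \<open>s + t\<close> times the
          generator belonging to this convex combination.\<close>
        let ?z = "(s/(s+t)) *\<^sub>R x + (t/(s+t)) *\<^sub>R y"
        have "?z \<in> D" using st False by (intro convexD[OF D]) (auto simp flip: add_divide_distrib)
        moreover have "(s + t) *\<^sub>R ?z = s *\<^sub>R x + t *\<^sub>R y" using False by (simp add: scaleR_add_right)
        then have "a + b = (- ((s + t) *\<^sub>R ?z), - ((s + t) * d))"
          using st by (simp only:) (simp add: algebra_simps)
        ultimately show ?thesis using st by (intro CollectI exI[of _ "s + t"] exI[of _ ?z]) auto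
      qed
    qed
    show "c *\<^sub>R a \<in> ?A" if ca: "0 \<le> c" "a \<in> ?A" for c a
    proof -
      obtain s x where "a = (- (s *\<^sub>R x), - (s * d))" "s \<ge> 0" "x \<in> D" using ca by blast
      then show ?thesis using ca(1) by (auto intro!: exI[of _ "c * s"] exI[of _ x])
    qed
  qed (auto intro!: mult_left_mono dist)
  then obtain g :: "'v \<Rightarrow>\<^sub>L real" where g: "norm g \<le> 1" "\<forall>(v, s) \<in> ?A. blinfun_apply g v \<le> s" by blast
  have "d \<le> g c" if "c \<in> D" for c
  proof -
    have "(- c, - d) \<in> ?A" using that by (auto intro!: exI[of _ 1])
    then have "g (- c) \<le> - d" using g(2) by blast
    then show ?thesis by (simp add: blinfun.minus_right)
  qed
  then show ?thesis using g(1) by blast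
qed

section \<open>Canonical embedding, second adjoint and Helly's theorem\<close>

lemma bidual_emb_apply [simp]: "blinfun_apply (bidual_emb x) f = f x"
  unfolding bidual_emb_def
  by (simp add: bounded_linear_Blinfun_apply bounded_linear_blinfun_apply[OF bounded_linear_ident])

lemma bidual_op_apply [simp]:
  fixes T :: "'a::real_normed_vector \<Rightarrow>\<^sub>L 'b::real_normed_vector"
  shows "blinfun_apply (blinfun_apply (bidual_op T) \<phi>) g = \<phi> (g o\<^sub>L T)"
proof -
  have inner: "bounded_linear (\<lambda>g. blinfun_apply \<phi> (g o\<^sub>L T))" for \<phi> :: "('a \<Rightarrow>\<^sub>L real) \<Rightarrow>\<^sub>L real"
    by (rule bounded_linear_compose[OF blinfun.bounded_linear_right])
      (rule bounded_bilinear.bounded_linear_left[OF bounded_bilinear_blinfun_compose])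
  have "bounded_linear (\<lambda>\<phi> :: ('a \<Rightarrow>\<^sub>L real) \<Rightarrow>\<^sub>L real. Blinfun (\<lambda>g. blinfun_apply \<phi> (g o\<^sub>L T)))"
  proof (rule bounded_linear_intro[where K = "norm T"])
    fix \<phi> \<psi> :: "('a \<Rightarrow>\<^sub>L real) \<Rightarrow>\<^sub>L real" and r :: real
    show "Blinfun (\<lambda>g. blinfun_apply (\<phi> + \<psi>) (g o\<^sub>L T)) = Blinfun (\<lambda>g. blinfun_apply \<phi> (g o\<^sub>L T)) + Blinfun (\<lambda>g. blinfun_apply \<psi> (g o\<^sub>L T))"
      by (rule blinfun_eqI) (simp add: bounded_linear_Blinfun_apply[OF inner]
          bounded_linear_Blinfun_apply[OF bounded_linear_add[OF inner inner]] blinfun.add_left)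
    show "Blinfun (\<lambda>g. blinfun_apply (r *\<^sub>R \<phi>) (g o\<^sub>L T)) = r *\<^sub>R Blinfun (\<lambda>g. blinfun_apply \<phi> (g o\<^sub>L T))"
      by (rule blinfun_eqI) (simp add: bounded_linear_Blinfun_apply[OF inner]
          bounded_linear_Blinfun_apply[OF bounded_linear_const_mult[OF inner]] blinfun.scaleR_left)
    show "norm (Blinfun (\<lambda>g. blinfun_apply \<phi> (g o\<^sub>L T))) \<le> norm \<phi> * norm T"
    proof (rule norm_blinfun_bound)
      fix g :: "'b \<Rightarrow>\<^sub>L real"
      have "norm (blinfun_apply \<phi> (g o\<^sub>L T)) \<le> norm \<phi> * norm (g o\<^sub>L T)" by (rule norm_blinfun)
      also have "\<dots> \<le> norm \<phi> * (norm g * norm T)"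
        by (intro mult_left_mono norm_blinfun_compose) simp
      finally show "norm (Blinfun (\<lambda>g. blinfun_apply \<phi> (g o\<^sub>L T)) g) \<le> norm \<phi> * norm T * norm g"
        by (simp add: bounded_linear_Blinfun_apply[OF inner] mult_ac)
    qed simp
  qed
  then show ?thesis
    unfolding bidual_op_def by (simp add: bounded_linear_Blinfun_apply bounded_linear_Blinfun_apply[OF inner])
qed

lemma bidual_emb_add: "bidual_emb (x + y) = bidual_emb x + bidual_emb y"
  by (rule blinfun_eqI) (simp add: blinfun.add_left blinfun.add_right)

lemma bidual_emb_scaleR: "bidual_emb (c *\<^sub>R x) = c *\<^sub>R bidual_emb x"
  by (rule blinfun_eqI) (simp add: blinfun.scaleR_left blinfun.scaleR_right)

lemma norm_bidual_emb [simp]: "norm (bidual_emb x) = norm x"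
proof (rule antisym)
  show "norm (bidual_emb x) \<le> norm x"
  proof (rule norm_blinfun_bound)
    fix f :: "'a \<Rightarrow>\<^sub>L real"
    show "norm (bidual_emb x f) \<le> norm x * norm f"
      using norm_blinfun[of f x] by (simp add: mult.commute)
  qed simp
  \<comment> \<open>Separating the singleton \<open>{x}\<close> from zero produces a norming
    functional for \<open>x\<close>.\<close>
  obtain g :: "'a \<Rightarrow>\<^sub>L real" where g: "norm g \<le> 1" "norm x \<le> g x"
    using functional_separating_convex_from_zero[of "{x}" "norm x"] by auto
  have "norm x \<le> norm (bidual_emb x g)" using g by simp
  also have "\<dots> \<le> norm (bidual_emb x) * norm g" by (rule norm_blinfun)
  also have "\<dots> \<le> norm (bidual_emb x)" using g(1) mult_left_mono[of "norm g" 1 "norm (bidual_emb x)"] by simp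
  finally show "norm x \<le> norm (bidual_emb x)" .
qed

lemma bounded_linear_bidual_emb: "bounded_linear bidual_emb"
  by (rule bounded_linear_intro[where K = 1]) (auto simp: bidual_emb_add bidual_emb_scaleR)

lemma closed_range_bidual_emb: "closed (range (bidual_emb :: 'a::banach \<Rightarrow> _))"
proof -
  show ?thesis
    by (rule complete_imp_closed, rule complete_isometric_image[where e = 1])
      (auto simp: bounded_linear_bidual_emb complete_UNIV)
qed

text \<open>If the image of the ball of radius \<open>norm \<phi>\<close>, translated by
  \<open>- w\<close>, stayed at distance \<open>d\<close> from zero, a separating \<open>g\<close>
  would satisfy \<open>norm \<phi> * norm (g o\<^sub>L S) \<le> - d - g w\<close>. Evaluating at
  \<open>g\<close> then makes the norm of \<open>bidual_op S \<phi> - bidual_emb w\<close> at least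
  \<open>d\<close>.\<close>

lemma Helly_bidual_approximation:
  fixes S :: "'a::real_normed_vector \<Rightarrow>\<^sub>L 'w::real_normed_vector"
  assumes d: "norm (bidual_op S \<phi> - bidual_emb w) < d"
  shows "\<exists>x. norm x \<le> norm \<phi> \<and> norm (S x - w) < d"
proof (rule ccontr)
  assume neg: "\<not> ?thesis"
  have "\<exists>g :: 'w \<Rightarrow>\<^sub>L real. norm g \<le> 1 \<and> (\<forall>c \<in> (\<lambda>x. S x - w) ` cball 0 (norm \<phi>). d \<le> blinfun_apply g c)"
  proof (rule functional_separating_convex_from_zero)
    have "(\<lambda>x. S x - w) ` cball 0 (norm \<phi>) = (\<lambda>u. - w + u) ` (S ` cball 0 (norm \<phi>))"
      by (auto simp: image_image)
    then show "convex ((\<lambda>x. S x - w) ` cball 0 (norm \<phi>))"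
      by (simp add: convex_translation convex_linear_image[OF bounded_linear.linear[OF blinfun.bounded_linear_right]])
  qed (use neg in auto)
  then obtain g :: "'w \<Rightarrow>\<^sub>L real"
    where g: "norm g \<le> 1" "\<And>x. norm x \<le> norm \<phi> \<Longrightarrow> d \<le> g (S x - w)" by auto
  have "norm \<phi> * norm (g o\<^sub>L S) \<le> - d - g w"
  proof -
    have "norm (norm \<phi> *\<^sub>R (g o\<^sub>L S)) \<le> - d - g w"
    proof (rule norm_blinfun_bound)
      show nn: "0 \<le> - d - g w" using g(2)[of 0] by (simp add: blinfun.minus_right)
      fix x :: 'a
      show "norm ((norm \<phi> *\<^sub>R (g o\<^sub>L S)) x) \<le> (- d - g w) * norm x"
      proof (cases "x = 0")
        case True
        then show ?thesis by simp
      next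
        case False
        let ?u = "(norm \<phi> / norm x) *\<^sub>R x"
        \<comment> \<open>The ball is symmetric, so the lower bound at \<open>?u\<close> and at
          \<open>- ?u\<close> gives a two-sided bound for \<open>g\<close> on its image.\<close>
        have "norm ?u \<le> norm \<phi>" "norm (- ?u) \<le> norm \<phi>" using False by auto
        from g(2)[OF this(1)] g(2)[OF this(2)]
        have "\<bar>norm \<phi> / norm x * g (S x)\<bar> \<le> - d - g w"
          by (simp add: abs_le_iff blinfun.diff_right blinfun.scaleR_right blinfun.minus_right)
        then show ?thesis using False by (simp add: blinfun.scaleR_left abs_mult field_simps)
      qed
    qed
    then show ?thesis by simp
  qed
  moreover have "\<bar>\<phi> (g o\<^sub>L S)\<bar> \<le> norm \<phi> * norm (g o\<^sub>L S)"
    using norm_blinfun[of \<phi> "g o\<^sub>L S"] by simp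
  ultimately have "d \<le> \<phi> (g o\<^sub>L S) - g w" by linarith
  also have "\<dots> = (bidual_op S \<phi> - bidual_emb w) g" by (simp add: blinfun.diff_left)
  also have "\<dots> \<le> norm (bidual_op S \<phi> - bidual_emb w) * norm g"
    using norm_blinfun[of "bidual_op S \<phi> - bidual_emb w" g] by simp
  also have "\<dots> \<le> norm (bidual_op S \<phi> - bidual_emb w)"
    using g(1) mult_left_mono[of "norm g" 1 "norm (bidual_op S \<phi> - bidual_emb w)"] by simp
  finally show False using d by simp
qed

text \<open>The functionals in \<open>F\<close> become additional coordinates, scaled by \<open>L\<close>, of an operator into
  \<open>(nat \<Rightarrow>\<^sub>C real) \<times> 'b\<close>.\<close>
lemma Helly_bidual_approximation_functionals:
  fixes T :: "'a::real_normed_vector \<Rightarrow>\<^sub>L 'b::real_normed_vector"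
  assumes d: "norm (bidual_op T \<phi> - bidual_emb y) < d"
    and F: "finite F" and e: "0 < e"
  shows "\<exists>x. norm x \<le> norm \<phi> \<and> norm (T x - y) < d \<and> (\<forall>f\<in>F. \<bar>blinfun_apply f x - \<phi> f\<bar> < e)"
proof -
  have d0: "0 < d" using d by (rule le_less_trans[OF norm_ge_zero])
  obtain n and h :: "nat \<Rightarrow> 'a \<Rightarrow>\<^sub>L real" where h: "F = h ` {i. i < n}"
    using finite_imp_nat_seg_image_inj_on[OF F] by blast
  \<comment> \<open>An error below \<open>d\<close> in a coordinate scaled by \<open>L\<close> is an
    error below \<open>e\<close> in the functional itself.\<close>
  define L where "L = d / e"
  have L: "L > 0" using d0 e by (simp add: L_def)
  \<comment> \<open>A copy of n-dimensional space with the sup norm, extended by zeros; its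
    dimension depends on \<open>F\<close>, whereas the type does not.\<close>
  define vec :: "(nat \<Rightarrow> real) \<Rightarrow> (nat \<Rightarrow>\<^sub>C real)" where
    "vec a = Bcontfun (\<lambda>i. if i < n then a i else 0)" for a
  have vec: "apply_bcontfun (vec a) i = (if i < n then a i else 0)" for a i
  proof -
    have "(\<lambda>i. if i < n then a i else 0) \<in> bcontfun"
      unfolding bcontfun_def
    proof (intro CollectI conjI)
      have "(\<lambda>i. if i < n then a i else 0) ` UNIV \<subseteq> insert 0 (a ` {..<n})" by auto
      then show "bounded (range (\<lambda>i. if i < n then a i else 0))"
        by (meson bounded_subset finite_imp_bounded finite_imageI finite_insert finite_lessThan)
    qed simp
    then show ?thesis by (simp add: vec_def Bcontfun_inverse)
  qed
  have vec_add: "vec (\<lambda>i. a i + b i) = vec a + vec b" for a b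
    by (rule bcontfun_eqI) (simp add: vec)
  have vec_scale: "vec (\<lambda>i. c * a i) = c *\<^sub>R vec a" for c a
    by (rule bcontfun_eqI) (simp add: vec)
  have vec_sum: "vec a = (\<Sum>i<n. a i *\<^sub>R vec (\<lambda>k. if k = i then 1 else 0))" for a
  proof -
    have "apply_bcontfun (\<Sum>i\<in>I. a i *\<^sub>R vec (\<lambda>k. if k = i then 1 else 0)) m
        = (\<Sum>i\<in>I. if m < n \<and> m = i then a i else 0)" if "finite I" for I m
      using that by (induction I rule: finite_induct) (auto simp: vec)
    then show ?thesis by (intro bcontfun_eqI) (auto simp: vec)
  qed
  define S where "S x = (vec (\<lambda>i. L * h i x), T x)" for x
  have bl: "bounded_linear S"
  proof (rule bounded_linear_intro)
    show "S (x + x') = S x + S x'" for x x'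
      by (simp add: S_def blinfun.add_right distrib_left vec_add)
    show "S (c *\<^sub>R x) = c *\<^sub>R S x" for c x
      by (simp add: S_def blinfun.scaleR_right vec_scale[symmetric] mult_ac)
    let ?K = "(\<Sum>i<n. L * norm (h i) * norm (vec (\<lambda>k. if k = i then 1 else 0))) + norm T"
    show "norm (S x) \<le> norm x * ?K" for x
    proof -
      have "norm (vec (\<lambda>i. L * h i x)) \<le> (\<Sum>i<n. norm ((L * h i x) *\<^sub>R vec (\<lambda>k. if k = i then 1 else 0)))"
        by (subst vec_sum) (rule norm_sum)
      also have "\<dots> \<le> (\<Sum>i<n. norm x * (L * norm (h i) * norm (vec (\<lambda>k. if k = i then 1 else 0))))"
      proof (rule sum_mono)
        fix i
        have "\<bar>h i x\<bar> \<le> norm (h i) * norm x" using norm_blinfun[of "h i" x] by simp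
        then have "L * \<bar>h i x\<bar> * norm (vec (\<lambda>k. if k = i then 1 else 0))
            \<le> L * (norm (h i) * norm x) * norm (vec (\<lambda>k. if k = i then 1 else 0))"
          using L by (intro mult_right_mono mult_left_mono) auto
        then show "norm ((L * h i x) *\<^sub>R vec (\<lambda>k. if k = i then 1 else 0))
            \<le> norm x * (L * norm (h i) * norm (vec (\<lambda>k. if k = i then 1 else 0)))"
          using L by (simp add: abs_mult mult_ac)
      qed
      finally have "norm (vec (\<lambda>i. L * h i x)) \<le> norm x * (\<Sum>i<n. L * norm (h i) * norm (vec (\<lambda>k. if k = i then 1 else 0)))"
        by (simp add: sum_distrib_left)
      moreover have "norm (S x) \<le> norm (vec (\<lambda>i. L * h i x)) + norm (T x)"
        unfolding S_def by (rule norm_Pair_le)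
      ultimately show ?thesis using norm_blinfun[of T x] by (simp add: algebra_simps)
    qed
  qed
  have S: "blinfun_apply (Blinfun S) x = S x" for x by (rule bounded_linear_Blinfun_apply[OF bl, THEN fun_cong])
  define w where "w = (vec (\<lambda>i. L * \<phi> (h i)), y)"
  have bl2: "bounded_linear (\<lambda>v. G (0, v))" if "bounded_linear G" for G :: "(nat \<Rightarrow>\<^sub>C real) \<times> 'b \<Rightarrow> real"
    by (rule bounded_linear_compose[OF that])
      (rule bounded_linear_Pair[OF bounded_linear_zero bounded_linear_ident])
  \<comment> \<open>The first component of \<open>w\<close> consists of the exact values of \<phi>,
    so the new coordinates cancel and only the restriction \<open>G2\<close> of \<open>G\<close> to
    the second factor contributes.\<close>
  have "norm (bidual_op (Blinfun S) \<phi> - bidual_emb w) \<le> norm (bidual_op T \<phi> - bidual_emb y)"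
  proof (rule norm_blinfun_bound)
    fix G :: "((nat \<Rightarrow>\<^sub>C real) \<times> 'b) \<Rightarrow>\<^sub>L real"
    define G2 where "G2 = Blinfun (\<lambda>v. G (0, v))"
    have G2: "blinfun_apply G2 v = G (0, v)" for v
      unfolding G2_def by (simp add: bounded_linear_Blinfun_apply bl2[OF blinfun.bounded_linear_right])
    have G2n: "norm G2 \<le> norm G"
    proof (rule norm_blinfun_bound)
      fix v
      show "norm (G2 v) \<le> norm G * norm v"
        using norm_blinfun[of G "(0, v)"] by (simp add: G2)
    qed simp
    have split: "G (vec a, v) = (\<Sum>i<n. a i * G (vec (\<lambda>k. if k = i then 1 else 0), 0)) + G2 v" for a v
    proof -
      have "(vec a, v) = (\<Sum>i<n. a i *\<^sub>R (vec (\<lambda>k. if k = i then 1 else 0), 0)) + (0, v)"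
        by (subst vec_sum) (simp add: prod_eq_iff fst_sum snd_sum)
      then have "G (vec a, v) = G ((\<Sum>i<n. a i *\<^sub>R (vec (\<lambda>k. if k = i then 1 else 0), 0)) + (0, v))"
        by simp
      also have "\<dots> = (\<Sum>i<n. a i * G (vec (\<lambda>k. if k = i then 1 else 0), 0)) + G2 v"
        unfolding G2 blinfun.add_right blinfun.sum_right blinfun.scaleR_right by simp
      finally show ?thesis .
    qed
    define \<gamma> where "\<gamma> i = G (vec (\<lambda>k. if k = i then 1 else 0), 0)" for i
    have "G o\<^sub>L Blinfun S = (\<Sum>i<n. (L * \<gamma> i) *\<^sub>R h i) + (G2 o\<^sub>L T)"
    proof (rule blinfun_eqI)
      fix x
      show "(G o\<^sub>L Blinfun S) x = ((\<Sum>i<n. (L * \<gamma> i) *\<^sub>R h i) + (G2 o\<^sub>L T)) x"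
        using split[of "\<lambda>i. L * h i x" "T x"]
        by (simp add: S S_def \<gamma>_def blinfun.add_left blinfun.sum_left blinfun.scaleR_left mult_ac)
    qed
    then have "\<phi> (G o\<^sub>L Blinfun S) = (\<Sum>i<n. L * \<gamma> i * \<phi> (h i)) + \<phi> (G2 o\<^sub>L T)"
      by (simp add: blinfun.add_right blinfun.sum_right blinfun.scaleR_right)
    moreover have "G w = (\<Sum>i<n. L * \<gamma> i * \<phi> (h i)) + G2 y"
      using split[of "\<lambda>i. L * \<phi> (h i)" y] by (simp add: w_def \<gamma>_def mult_ac)
    ultimately have "(bidual_op (Blinfun S) \<phi> - bidual_emb w) G = (bidual_op T \<phi> - bidual_emb y) G2"
      by (simp add: blinfun.diff_left)
    also have "norm \<dots> \<le> norm (bidual_op T \<phi> - bidual_emb y) * norm G2" by (rule norm_blinfun)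
    also have "\<dots> \<le> norm (bidual_op T \<phi> - bidual_emb y) * norm G" using G2n by (rule mult_left_mono) simp
    finally show "norm ((bidual_op (Blinfun S) \<phi> - bidual_emb w) G) \<le> norm (bidual_op T \<phi> - bidual_emb y) * norm G" .
  qed simp
  then obtain x where x: "norm x \<le> norm \<phi>" "norm (S x - w) < d"
    using Helly_bidual_approximation[of "Blinfun S" \<phi> w d] d S by auto
  have "norm (T x - y) \<le> norm (S x - w)"
    using norm_snd_le[of "snd (S x - w)" "fst (S x - w)"] by (simp add: S_def w_def)
  moreover have "\<bar>f x - \<phi> f\<bar> < e" if f: "f \<in> F" for f
  proof -
    obtain i where i: "f = h i" "i < n" using f h by auto
    have "\<bar>apply_bcontfun (fst (S x - w)) i\<bar> \<le> norm (fst (S x - w))"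
      using norm_bounded[of "fst (S x - w)" i] by simp
    also have "\<dots> \<le> norm (S x - w)" using norm_fst_le[of "fst (S x - w)" "snd (S x - w)"]
      by (simp only: prod.collapse)
    finally have "\<bar>L * f x - L * \<phi> f\<bar> < d" using x i by (simp add: S_def w_def vec)
    moreover have "\<bar>L * f x - L * \<phi> f\<bar> = L * \<bar>f x - \<phi> f\<bar>"
      using L by (simp add: abs_mult flip: right_diff_distrib)
    ultimately show ?thesis using d0 e by (simp add: L_def field_simps)
  qed
  ultimately show ?thesis using x by (intro exI[of _ x]) auto
qed

section \<open>Duality consequences of a lower bound for \<open>T^co\<close>\<close>

text \<open>If \<open>bidual_op T \<phi>\<close> lies in the canonical image, its distance there is
  0, hence so is that of \<phi>. Completeness of the domain makes its canonical image
  closed.\<close>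

lemma Tco_isomorphism_into_imp_tauberian:
  fixes T :: "'a::banach \<Rightarrow>\<^sub>L 'b::real_normed_vector"
  assumes "Tco_isomorphism_into T"
  shows "tauberian T"
  unfolding tauberian_def
proof (intro allI impI)
  fix \<phi> assume T: "bidual_op T \<phi> \<in> range bidual_emb"
  obtain c where c: "c > 0" "c * infdist \<phi> (range bidual_emb) \<le> infdist (bidual_op T \<phi>) (range bidual_emb)"
    using assms unfolding Tco_isomorphism_into_def by blast
  then have "c * infdist \<phi> (range bidual_emb) \<le> 0" using T by simp
  then have "infdist \<phi> (range bidual_emb) = 0"
    using c(1) infdist_nonneg[of \<phi> "range bidual_emb"] by (simp add: mult_le_0_iff)
  then show "\<phi> \<in> range bidual_emb"
    using in_closed_iff_infdist_zero[OF closed_range_bidual_emb] by blast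
qed

text \<open>The bound on \<open>T^co\<close> makes its adjoint surjective: functionals on \<open>X**\<close> vanishing on \<open>X\<close> factor
  through \<open>T**\<close>.\<close>
lemma Tco_isomorphism_into_adjoint_surjective:
  fixes T :: "'a::real_normed_vector \<Rightarrow>\<^sub>L 'b::real_normed_vector"
    and \<xi> :: "(('a \<Rightarrow>\<^sub>L real) \<Rightarrow>\<^sub>L real) \<Rightarrow>\<^sub>L real"
  assumes T: "Tco_isomorphism_into T" and \<xi>: "\<And>x. blinfun_apply \<xi> (bidual_emb x) = 0"
  shows "\<exists>\<eta>. \<eta> o\<^sub>L bidual_op T = \<xi>"
proof -
  obtain c where c: "c > 0" "\<And>\<phi>. c * infdist \<phi> (range bidual_emb) \<le> infdist (bidual_op T \<phi>) (range bidual_emb)"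
    using T unfolding Tco_isomorphism_into_def by blast
  \<comment> \<open>Since \<xi> vanishes on the canonical image, it is controlled by the quotient
    norm.\<close>
  have le_infdist: "\<bar>\<xi> \<phi>\<bar> \<le> norm \<xi> * infdist \<phi> (range bidual_emb)" for \<phi>
  proof (rule field_le_epsilon)
    fix e :: real assume e: "e > 0"
    have "infdist \<phi> (range bidual_emb) < infdist \<phi> (range bidual_emb) + e / (norm \<xi> + 1)"
      using e by (simp add: divide_pos_pos add_nonneg_pos)
    then obtain x where x: "dist \<phi> (bidual_emb x) < infdist \<phi> (range bidual_emb) + e / (norm \<xi> + 1)"
      by (subst (asm) infdist_def) (auto simp: cINF_less_iff)
    have "\<bar>\<xi> \<phi>\<bar> = norm (\<xi> (\<phi> - bidual_emb x))" by (simp add: blinfun.diff_right \<xi>)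
    also have "\<dots> \<le> norm \<xi> * dist \<phi> (bidual_emb x)" unfolding dist_norm by (rule norm_blinfun)
    also have "\<dots> \<le> norm \<xi> * (infdist \<phi> (range bidual_emb) + e / (norm \<xi> + 1))"
      using x by (intro mult_left_mono) auto
    also have "\<dots> \<le> norm \<xi> * infdist \<phi> (range bidual_emb) + e"
      using e by (simp add: distrib_left divide_le_eq add_nonneg_pos mult_left_mono mult.commute)
    finally show "\<bar>\<xi> \<phi>\<bar> \<le> norm \<xi> * infdist \<phi> (range bidual_emb) + e" .
  qed
  \<comment> \<open>This is a linear subspace of pairs. The resulting inequality, applied to \<phi>
    and to \<open>- \<phi>\<close>, prescribes the values of \<open>g\<close> on the range of
    \<open>bidual_op T\<close>.\<close>
  let ?A = "range (\<lambda>\<phi>. (bidual_op T \<phi>, \<xi> \<phi>))"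
  have "\<exists>g. norm g \<le> norm \<xi> / c \<and> (\<forall>(v, s) \<in> ?A. blinfun_apply g v \<le> s)"
  proof (rule bounded_functional_below_cone)
    show "0 \<le> norm \<xi> / c" using c by simp
    show "(0, 0) \<in> ?A" by (auto intro!: image_eqI[of _ _ 0])
    show "a + b \<in> ?A" if "a \<in> ?A" "b \<in> ?A" for a b
    proof -
      from that obtain \<phi> \<psi> where "a = (bidual_op T \<phi>, \<xi> \<phi>)" "b = (bidual_op T \<psi>, \<xi> \<psi>)" by auto
      then show ?thesis by (auto intro!: image_eqI[of _ _ "\<phi> + \<psi>"] simp: blinfun.add_right)
    qed
    show "r *\<^sub>R a \<in> ?A" if "0 \<le> r" "a \<in> ?A" for r a
    proof -
      from that obtain \<phi> where "a = (bidual_op T \<phi>, \<xi> \<phi>)" by auto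
      then show ?thesis by (auto intro!: image_eqI[of _ _ "r *\<^sub>R \<phi>"] simp: blinfun.scaleR_right)
    qed
    show "0 \<le> norm \<xi> / c * norm v + s" if "(v, s) \<in> ?A" for v s
    proof -
      from that obtain \<phi> where v: "v = bidual_op T \<phi>" "s = \<xi> \<phi>" by auto
      have "infdist v (range bidual_emb) \<le> norm v"
        using infdist_le[OF rangeI[of bidual_emb 0], of v]
        by (simp add: dist_norm linear_0[OF bounded_linear.linear[OF bounded_linear_bidual_emb]])
      then have "infdist \<phi> (range bidual_emb) \<le> norm v / c"
        using c(2)[of \<phi>] c(1) v by (simp add: field_simps)
      then have "\<bar>s\<bar> \<le> norm \<xi> * (norm v / c)"
        using le_infdist[of \<phi>] v mult_left_mono[of _ _ "norm \<xi>"] by (meson norm_ge_zero order.trans)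
      then show ?thesis by (simp add: abs_le_iff)
    qed
  qed
  then obtain g where g: "\<And>\<phi>. blinfun_apply g (bidual_op T \<phi>) \<le> \<xi> \<phi>" by auto
  have "g (bidual_op T \<phi>) = \<xi> \<phi>" for \<phi>
    using g[of \<phi>] g[of "- \<phi>"] by (simp add: blinfun.minus_right)
  then show ?thesis by (intro exI[of _ g] blinfun_eqI) simp
qed

text \<open>Dixmier's splitting writes \<Phi> as the image of \<phi>, its restriction to the
  embedded dual, plus a part \<Phi>' annihilating that dual. The hypothesis on \<Phi> makes \<Phi>'
  vanish on everything factoring through \<open>bidual_op T\<close>, which leaves nothing.\<close>

lemma Tco_isomorphism_into_imp_tauberian_bidual:
  fixes T :: "'a::real_normed_vector \<Rightarrow>\<^sub>L 'b::real_normed_vector"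
  assumes T: "Tco_isomorphism_into T"
  shows "tauberian (bidual_op T)"
  unfolding tauberian_def
proof (intro allI impI)
  fix \<Phi> assume "bidual_op (bidual_op T) \<Phi> \<in> range bidual_emb"
  then obtain \<psi> where \<psi>: "bidual_op (bidual_op T) \<Phi> = bidual_emb \<psi>" by auto
  define J :: "('a \<Rightarrow>\<^sub>L real) \<Rightarrow>\<^sub>L _" where "J = Blinfun bidual_emb"
  have J: "blinfun_apply J f = bidual_emb f" for f
    by (simp add: J_def bounded_linear_Blinfun_apply[OF bounded_linear_bidual_emb])
  define \<phi> where "\<phi> = \<Phi> o\<^sub>L J"
  define \<Phi>' where "\<Phi>' = \<Phi> - bidual_emb \<phi>"
  have ann: "\<Phi>' (bidual_emb f) = 0" for f
    by (simp add: \<Phi>'_def blinfun.diff_left \<phi>_def J)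
  have emb_comp: "bidual_emb g o\<^sub>L bidual_op T = bidual_emb (g o\<^sub>L T)" for g
    by (rule blinfun_eqI) simp
  have "\<psi> = bidual_op T \<phi>"
  proof (rule blinfun_eqI)
    fix g
    have "\<psi> g = bidual_op (bidual_op T) \<Phi> (bidual_emb g)" by (simp add: \<psi>)
    also have "\<dots> = bidual_op T \<phi> g" by (simp add: emb_comp \<phi>_def J)
    finally show "\<psi> g = bidual_op T \<phi> g" .
  qed
  then have zero: "\<Phi>' (\<eta> o\<^sub>L bidual_op T) = 0" for \<eta>
    using arg_cong[OF \<psi>, of "\<lambda>F. blinfun_apply F \<eta>"] by (simp add: \<Phi>'_def blinfun.diff_left)
  have "\<Phi>' = 0"
  proof (rule blinfun_eqI)
    fix \<xi>
    define E :: "'a \<Rightarrow>\<^sub>L _" where "E = Blinfun bidual_emb"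
    have E: "blinfun_apply E x = bidual_emb x" for x
      by (simp add: E_def bounded_linear_Blinfun_apply[OF bounded_linear_bidual_emb])
    \<comment> \<open>The same splitting one level lower: the subtracted term comes from the dual
      and is killed by \<Phi>'; the remainder vanishes on the embedded space and so factors through
      \<open>bidual_op T\<close>.\<close>
    let ?\<xi> = "\<xi> - bidual_emb (\<xi> o\<^sub>L E)"
    have "\<exists>\<eta>. \<eta> o\<^sub>L bidual_op T = ?\<xi>"
      by (rule Tco_isomorphism_into_adjoint_surjective[OF T]) (simp add: blinfun.diff_left E)
    then have "\<Phi>' ?\<xi> = 0" using zero by metis
    then show "\<Phi>' \<xi> = blinfun_apply 0 \<xi>" by (simp add: blinfun.diff_right ann)
  qed
  then show "\<Phi> \<in> range bidual_emb" by (simp add: \<Phi>'_def)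
qed

section \<open>Banach lattices represented in an L1 space\<close>

text \<open>One coefficient sequence serves all sufficiently long sums, so that the length can later
  be raised beyond any prescribed cutoff.\<close>

lemma span_range_eq_sum:
  fixes y :: "nat \<Rightarrow> 'a::real_vector"
  assumes "v \<in> span (range y)"
  shows "\<exists>n a. \<forall>m\<ge>n. v = (\<Sum>i<m. a i *\<^sub>R y i)"
  using assms
proof (induction rule: span_induct_alt)
  case base
  show ?case by (intro exI[of _ 0] exI[of _ "\<lambda>_. 0"]) simp
next
  case (step c x v)
  then obtain k n a where k: "x = y k" and a: "\<And>m. m \<ge> n \<Longrightarrow> v = (\<Sum>i<m. a i *\<^sub>R y i)" by auto
  let ?a = "\<lambda>i. a i + (if i = k then c else 0)"
  have "c *\<^sub>R x + v = (\<Sum>i<m. ?a i *\<^sub>R y i)" if m: "m \<ge> max n (Suc k)" for m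
  proof -
    have "(\<Sum>i<m. ?a i *\<^sub>R y i) = (\<Sum>i<m. a i *\<^sub>R y i) + (\<Sum>i<m. if i = k then c *\<^sub>R y i else 0)"
      by (simp add: scaleR_add_left sum.distrib if_distrib[of "\<lambda>t. t *\<^sub>R _"] cong: if_cong)
    then show ?thesis using m k a[of m] by simp
  qed
  then show ?case by (intro exI[of _ "max n (Suc k)"] exI[of _ ?a]) blast
qed

text \<open>Inside \<open>Z\<close> the kernel of one functional has codimension at most one, so
  each induction step adds at most one spanning vector. Contrapositively, an infinite-dimensional
  subspace contains a non-zero vector on which the first \<open>N\<close> functionals
  vanish.\<close>

lemma finite_dimensional_if_functionals_separate:
  fixes \<kappa> :: "nat \<Rightarrow> 'a::real_vector \<Rightarrow> real"
  assumes "\<And>i. linear (\<kappa> i)" and "subspace Z"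
    and "\<And>z. z \<in> Z \<Longrightarrow> (\<forall>i<N. \<kappa> i z = 0) \<Longrightarrow> z = 0"
  shows "\<exists>B. finite B \<and> Z \<subseteq> span B"
  using assms(2,3)
proof (induction N arbitrary: Z)
  case 0
  then have "Z \<subseteq> span {}" by auto
  then show ?case by blast
next
  case (Suc N)
  let ?Z = "{z \<in> Z. \<kappa> N z = 0}"
  note lin = linear_add[OF assms(1)] linear_diff[OF assms(1)] linear_scale[OF assms(1)] linear_0[OF assms(1)]
  have "subspace ?Z"
    using Suc.prems(1) by (auto simp: subspace_def lin)
  then obtain B where B: "finite B" "?Z \<subseteq> span B"
    using Suc.IH[of ?Z] Suc.prems(2) by (auto simp: less_Suc_eq)
  show ?case
  proof (cases "\<forall>z\<in>Z. \<kappa> N z = 0")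
    case True
    then show ?thesis using B by auto
  next
    case False
    then obtain z0 where z0: "z0 \<in> Z" "\<kappa> N z0 \<noteq> 0" by auto
    have "z \<in> span (insert z0 B)" if "z \<in> Z" for z
    proof -
      have "z - (\<kappa> N z / \<kappa> N z0) *\<^sub>R z0 \<in> ?Z"
        using that z0 Suc.prems(1) by (auto simp: lin subspace_diff subspace_scale)
      then show ?thesis using B(2) unfolding span_insert by blast
    qed
    then show ?thesis using B(1) by (intro exI[of _ "insert z0 B"]) auto
  qed
qed

lemma L1_norm_nonneg: "0 \<le> L1_norm M f"
  by (simp add: L1_norm_def)

lemma (in prob_space) prob_abs_gt_le:
  assumes f: "integrable M f" and t: "0 < t"
  shows "prob {\<omega> \<in> space M. \<bar>f \<omega>\<bar> > t} \<le> L1_norm M f / t"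
proof -
  have [measurable]: "f \<in> borel_measurable M" using f by simp
  have "prob {\<omega> \<in> space M. \<bar>f \<omega>\<bar> > t} \<le> prob {\<omega> \<in> space M. \<bar>f \<omega>\<bar> \<ge> t}"
    by (rule finite_measure_mono) auto
  also have "\<dots> \<le> (\<integral>\<omega>. \<bar>f \<omega>\<bar> \<partial>M) / t"
    by (rule integral_Markov_inequality_measure[where A = "space M"]) (use f t in auto)
  finally show ?thesis by (simp add: L1_norm_def)
qed

section \<open>The represented lattice and its pointwise calculus\<close>

locale L1_represented_lattice =
  fixes M :: "'w measure" and j :: "'a::{banach,ordered_real_vector,lattice} \<Rightarrow> 'w \<Rightarrow> real"
  assumes lattice: "banach_lattice TYPE('a)"
    and order_cont: "order_continuous TYPE('a)"
    and rep: "L1_representation M j"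
begin

sublocale prob_space M
  using rep by (simp add: L1_representation_def)

lemma j_integrable [simp]: "integrable M (j x)"
  and j_add: "AE \<omega> in M. j (x + y) \<omega> = j x \<omega> + j y \<omega>"
  and j_scaleR: "AE \<omega> in M. j (c *\<^sub>R x) \<omega> = c * j x \<omega>"
  and j_le_iff: "x \<le> y \<longleftrightarrow> (AE \<omega> in M. j x \<omega> \<le> j y \<omega>)"
  and ess_bounded_in_range:
    "f \<in> borel_measurable M \<Longrightarrow> ess_bounded M f \<Longrightarrow> \<exists>x. AE \<omega> in M. j x \<omega> = f \<omega>"
  and dense_ess_bounded: "0 < e \<Longrightarrow> \<exists>x'. ess_bounded M (j x') \<and> norm (x - x') < e"
  and norm_le_ess_bound: "AE \<omega> in M. \<bar>j x \<omega>\<bar> \<le> C \<Longrightarrow> norm x \<le> 2 * C"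
  using rep by (simp_all add: L1_representation_def)

lemma j_measurable [measurable]: "j x \<in> borel_measurable M"
  using j_integrable by (rule borel_measurable_integrable)

lemma j_zero: "AE \<omega> in M. j 0 \<omega> = 0"
  using j_scaleR[of 0 0] by simp

lemma j_diff: "AE \<omega> in M. j (x - y) \<omega> = j x \<omega> - j y \<omega>"
  using j_add[of x "- 1 *\<^sub>R y"] j_scaleR[of "- 1" y] by eventually_elim simp

lemma j_sum:
  assumes "finite I"
  shows "AE \<omega> in M. j (\<Sum>i\<in>I. a i *\<^sub>R y i) \<omega> = (\<Sum>i\<in>I. a i * j (y i) \<omega>)"
  using assms
proof (induction I rule: finite_induct)
  case empty
  then show ?case using j_zero by simp
next
  case (insert i I)
  show ?case using insert.IH j_add[of "a i *\<^sub>R y i" "\<Sum>i\<in>I. a i *\<^sub>R y i"] j_scaleR[of "a i" "y i"]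
    by eventually_elim (use insert in simp)
qed

lemma j_eqI:
  assumes "AE \<omega> in M. j x \<omega> = j y \<omega>"
  shows "x = y"
proof (rule antisym)
  show "x \<le> y" unfolding j_le_iff using assms by eventually_elim simp
  show "y \<le> x" unfolding j_le_iff using assms by eventually_elim simp
qed

lemma j_L1_bound: "\<exists>K>0. \<forall>x. L1_norm M (j x) \<le> K * norm x"
proof -
  obtain K where K: "\<And>x. L1_norm M (j x) \<le> K * norm x"
    using rep by (auto simp: L1_representation_def)
  have "L1_norm M (j x) \<le> (max K 1) * norm x" for x
    by (rule order.trans[OF K mult_right_mono]) auto
  then show ?thesis by (intro exI[of _ "max K 1"]) auto
qed

text \<open>Boundedness puts the function \<open>\<bar>j x \<omega>\<bar>\<close> in the range of
  \<open>j\<close>; its preimage is the least upper bound of \<open>x\<close> and \<open>- x\<close>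
  because the order is the almost-everywhere order.\<close>

lemma j_labs:
  assumes "ess_bounded M (j x)"
  shows "AE \<omega> in M. j (labs x) \<omega> = \<bar>j x \<omega>\<bar>"
proof -
  have "ess_bounded M (\<lambda>\<omega>. \<bar>j x \<omega>\<bar>)" using assms by (simp add: ess_bounded_def)
  then obtain z where z: "AE \<omega> in M. j z \<omega> = \<bar>j x \<omega>\<bar>"
    using ess_bounded_in_range[of "\<lambda>\<omega>. \<bar>j x \<omega>\<bar>"] by auto
  have neg: "AE \<omega> in M. j (- x) \<omega> = - j x \<omega>" using j_scaleR[of "- 1" x] by simp
  have "labs x = z"
    unfolding labs_def
  proof (rule antisym)
    show "sup x (- x) \<le> z"
    proof (rule sup_least)
      show "x \<le> z" unfolding j_le_iff using z by eventually_elim simp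
      show "- x \<le> z" unfolding j_le_iff using z neg by eventually_elim simp
    qed
    have "x \<le> sup x (- x)" "- x \<le> sup x (- x)" by auto
    then have "AE \<omega> in M. j x \<omega> \<le> j (sup x (- x)) \<omega>" "AE \<omega> in M. j (- x) \<omega> \<le> j (sup x (- x)) \<omega>"
      by (simp_all only: j_le_iff)
    then show "z \<le> sup x (- x)" unfolding j_le_iff using z neg by eventually_elim simp
  qed
  then show ?thesis using z by simp
qed

lemma norm_mono_ess_bounded:
  assumes "ess_bounded M (j x)" "ess_bounded M (j y)" "AE \<omega> in M. \<bar>j x \<omega>\<bar> \<le> \<bar>j y \<omega>\<bar>"
  shows "norm x \<le> norm y"
proof -
  have "labs x \<le> labs y"
    unfolding j_le_iff using j_labs[OF assms(1)] j_labs[OF assms(2)] assms(3) by eventually_elim simp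
  then show ?thesis using lattice by (simp add: banach_lattice_def)
qed

lemma inf_labs_eq_zero:
  assumes "ess_bounded M (j x)" "ess_bounded M (j y)" "AE \<omega> in M. j x \<omega> = 0 \<or> j y \<omega> = 0"
  shows "inf (labs x) (labs y) = 0"
proof (rule antisym)
  have "inf (labs x) (labs y) \<le> labs x" "inf (labs x) (labs y) \<le> labs y" by auto
  then have "AE \<omega> in M. j (inf (labs x) (labs y)) \<omega> \<le> j (labs x) \<omega>"
      "AE \<omega> in M. j (inf (labs x) (labs y)) \<omega> \<le> j (labs y) \<omega>"
    by (simp_all only: j_le_iff)
  then show "inf (labs x) (labs y) \<le> 0"
    unfolding j_le_iff using assms(3) j_labs[OF assms(1)] j_labs[OF assms(2)] j_zero
    by eventually_elim auto
  show "0 \<le> inf (labs x) (labs y)"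
  proof (rule inf_greatest)
    show "0 \<le> labs x" unfolding j_le_iff using j_labs[OF assms(1)] j_zero by eventually_elim simp
    show "0 \<le> labs y" unfolding j_le_iff using j_labs[OF assms(2)] j_zero by eventually_elim simp
  qed
qed

text \<open>Order continuity is applied to the set of all \<open>u k\<close>. A lower bound of it is
  nonpositive at almost every point, since almost every point eventually leaves the sets
  \<open>B k\<close>.\<close>

lemma norm_indicator_vanishes:
  assumes u: "\<And>k. AE \<omega> in M. j (u k) \<omega> = indicator (B k) \<omega>"
    and dec: "decseq B"
    and lim: "AE \<omega> in M. \<exists>k. \<omega> \<notin> B k"
    and e: "0 < e"
  shows "\<exists>k. \<forall>i\<ge>k. norm (u i) < e"
proof -
  have mono: "u i \<le> u k" if "k \<le> i" for i k
    unfolding j_le_iff using u[of i] u[of k]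
  proof eventually_elim
    case (elim \<omega>)
    then show ?case using decseqD[OF dec that] by (auto simp: indicator_def)
  qed
  have "\<exists>x0\<in>range u. \<forall>z\<in>range u. z \<le> x0 \<longrightarrow> norm z < e"
  proof -
    have directed: "\<exists>z\<in>range u. z \<le> x \<and> z \<le> y" if xy: "x \<in> range u" "y \<in> range u" for x y
    proof -
      obtain k l where "x = u k" "y = u l" using xy by auto
      then show ?thesis using mono[of k "max k l"] mono[of l "max k l"] by auto
    qed
    have nonneg: "0 \<le> u k" for k
      unfolding j_le_iff using u[of k] j_zero by eventually_elim simp
    have inf0: "l \<le> 0" if "\<forall>x\<in>range u. l \<le> x" for l
    proof -
      have "AE \<omega> in M. \<forall>k. j l \<omega> \<le> j (u k) \<omega>"
        unfolding AE_all_countable using that by (auto simp flip: j_le_iff)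
      moreover have "AE \<omega> in M. \<forall>k. j (u k) \<omega> = indicator (B k) \<omega>"
        unfolding AE_all_countable using u by simp
      ultimately show ?thesis unfolding j_le_iff using j_zero lim
      proof eventually_elim
        case (elim \<omega>)
        then obtain k where "\<omega> \<notin> B k" by auto
        then show ?case using elim by (metis indicator_simps(2))
      qed
    qed
    have "range u \<noteq> {} \<and> (\<forall>x\<in>range u. \<forall>y\<in>range u. \<exists>z\<in>range u. z \<le> x \<and> z \<le> y)
        \<and> (\<forall>x\<in>range u. 0 \<le> x) \<and> (\<forall>l. (\<forall>x\<in>range u. l \<le> x) \<longrightarrow> l \<le> 0)"
    proof (intro conjI)
      show "\<forall>x\<in>range u. \<forall>y\<in>range u. \<exists>z\<in>range u. z \<le> x \<and> z \<le> y" using directed by blast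
      show "\<forall>x\<in>range u. 0 \<le> x" using nonneg by blast
      show "\<forall>l. (\<forall>x\<in>range u. l \<le> x) \<longrightarrow> l \<le> 0" using inf0 by blast
    qed simp
    from order_cont[unfolded order_continuous_def, THEN spec, THEN mp, OF this] e
    show ?thesis by blast
  qed
  then obtain k where "\<forall>z\<in>range u. z \<le> u k \<longrightarrow> norm z < e" by blast
  then show ?thesis using mono by blast
qed

text \<open>The coefficient of \<open>y i\<close> is the integral against the sign of \<open>y i\<close>, which is a bounded functional
  on the whole lattice.\<close>
lemma strictly_singular_on_disjoint_span:
  fixes T :: "'a \<Rightarrow>\<^sub>L 'b::banach"
  assumes bdd: "\<And>n. ess_bounded M (j (y n))"
    and lower: "\<And>n. 1/2 \<le> norm (y n)"
    and disj: "\<And>n m. n \<noteq> m \<Longrightarrow> AE \<omega> in M. j (y n) \<omega> = 0 \<or> j (y m) \<omega> = 0"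
    and summ: "summable (\<lambda>n. norm (T (y n)))"
  shows "strictly_singular_on (blinfun_apply T) (closure (span (range y)))"
  unfolding strictly_singular_on_def
proof (intro allI impI notI, elim conjE)
  fix Z assume Z: "subspace Z" "closed Z" "Z \<subseteq> closure (span (range y))"
    and inf: "\<not> (\<exists>B. finite B \<and> Z \<subseteq> span B)" and below: "bounded_below_on (blinfun_apply T) Z"
  obtain c where c: "c > 0" "\<And>z. z \<in> Z \<Longrightarrow> c * norm z \<le> norm (T z)"
    using below unfolding bounded_below_on_def by blast
  obtain K where K: "K > 0" "\<And>x. L1_norm M (j x) \<le> K * norm x" using j_L1_bound by blast
  have pos: "0 < L1_norm M (j (y i))" for i
  proof (rule ccontr)
    assume "\<not> 0 < L1_norm M (j (y i))"
    then have "L1_norm M (j (y i)) = 0" using L1_norm_nonneg[of M "j (y i)"] by simp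
    then have "AE \<omega> in M. j (y i) \<omega> = 0"
      using integral_nonneg_eq_0_iff_AE[of M "\<lambda>\<omega>. \<bar>j (y i) \<omega>\<bar>"]
      by (simp add: L1_norm_def integrable_abs)
    then have "AE \<omega> in M. j (y i) \<omega> = j 0 \<omega>" using j_zero by eventually_elim simp
    then have "y i = 0" by (rule j_eqI)
    then show False using lower[of i] by simp
  qed
  have int: "integrable M (\<lambda>\<omega>. j z \<omega> * sgn (j (y i) \<omega>))" for z i
  proof (rule Bochner_Integration.integrable_bound[OF j_integrable[of z]])
    show "AE \<omega> in M. norm (j z \<omega> * sgn (j (y i) \<omega>)) \<le> norm (j z \<omega>)"
      by (rule AE_I2) (simp add: abs_mult abs_sgn_eq)
  qed measurable
  define \<kappa> where "\<kappa> i z = (\<integral>\<omega>. j z \<omega> * sgn (j (y i) \<omega>) \<partial>M) / L1_norm M (j (y i))" for i z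
  have lin: "linear (\<kappa> i)" for i
  proof (rule linearI)
    fix x z and r :: real
    have "(\<integral>\<omega>. j (x + z) \<omega> * sgn (j (y i) \<omega>) \<partial>M)
        = (\<integral>\<omega>. j x \<omega> * sgn (j (y i) \<omega>) + j z \<omega> * sgn (j (y i) \<omega>) \<partial>M)"
      by (rule integral_cong_AE)
        (measurable, use j_add[of x z] in \<open>eventually_elim, simp add: distrib_right\<close>)
    then show "\<kappa> i (x + z) = \<kappa> i x + \<kappa> i z"
      by (simp add: \<kappa>_def int add_divide_distrib)
    have "(\<integral>\<omega>. j (r *\<^sub>R x) \<omega> * sgn (j (y i) \<omega>) \<partial>M) = (\<integral>\<omega>. r * (j x \<omega> * sgn (j (y i) \<omega>)) \<partial>M)"
      by (rule integral_cong_AE)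
        (measurable, use j_scaleR[of r x] in \<open>eventually_elim, simp\<close>)
    then show "\<kappa> i (r *\<^sub>R x) = r *\<^sub>R \<kappa> i x"
      by (simp add: \<kappa>_def)
  qed
  have \<kappa>_le: "\<bar>\<kappa> i z\<bar> \<le> K / L1_norm M (j (y i)) * norm z" for i z
  proof -
    have "\<bar>\<integral>\<omega>. j z \<omega> * sgn (j (y i) \<omega>) \<partial>M\<bar> \<le> (\<integral>\<omega>. \<bar>j z \<omega> * sgn (j (y i) \<omega>)\<bar> \<partial>M)"
      by (rule integral_abs_bound)
    also have "\<dots> \<le> L1_norm M (j z)"
      unfolding L1_norm_def
      by (rule integral_mono[OF integrable_abs[OF int] integrable_abs[OF j_integrable]])
        (simp add: abs_mult abs_sgn_eq)
    also have "\<dots> \<le> K * norm z" by (rule K)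
    finally show ?thesis using pos[of i] by (simp add: \<kappa>_def divide_right_mono)
  qed
  have all_disj: "AE \<omega> in M. \<forall>n m. n \<noteq> m \<longrightarrow> j (y n) \<omega> = 0 \<or> j (y m) \<omega> = 0"
    unfolding AE_all_countable using disj by auto
  \<comment> \<open>By disjointness, at a point where \<open>y k\<close> is non-zero only the
    \<open>k\<close>-th term of the sum survives. This yields both the coefficient formula and its
    norm bound.\<close>
  have comb: "AE \<omega> in M. j (\<Sum>i<n. a i *\<^sub>R y i) \<omega> = a k * j (y k) \<omega> \<or> j (y k) \<omega> = 0" if "k < n" for a n k
    using all_disj j_sum[of "{..<n}" a y, simplified]
  proof eventually_elim
    case (elim \<omega>)
    have "(\<Sum>i<n. a i * j (y i) \<omega>) = a k * j (y k) \<omega>" if "j (y k) \<omega> \<noteq> 0"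
    proof -
      have "(\<Sum>i<n. a i * j (y i) \<omega>) = (\<Sum>i<n. if i = k then a i * j (y i) \<omega> else 0)"
        using elim that by (intro sum.cong) auto
      then show ?thesis using \<open>k < n\<close> by simp
    qed
    then show ?case using elim by auto
  qed
  have coeff: "\<kappa> k (\<Sum>i<n. a i *\<^sub>R y i) = a k" if "k < n" for a n k
  proof -
    have "(\<integral>\<omega>. j (\<Sum>i<n. a i *\<^sub>R y i) \<omega> * sgn (j (y k) \<omega>) \<partial>M) = (\<integral>\<omega>. a k * \<bar>j (y k) \<omega>\<bar> \<partial>M)"
      by (rule integral_cong_AE)
        (measurable, use comb[OF that, of a] in \<open>eventually_elim, auto simp: abs_sgn mult_ac\<close>)
    then show ?thesis using pos[of k] by (simp add: \<kappa>_def L1_norm_def)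
  qed
  \<comment> \<open>Pointwise \<open>a k *\<^sub>R y k\<close> is dominated by the whole sum; the
    factor 2 compensates for \<open>1/2 \<le> norm (y k)\<close>.\<close>
  have coeff_le: "\<bar>a k\<bar> \<le> 2 * norm (\<Sum>i<n. a i *\<^sub>R y i)" if "k < n" for a n k
  proof -
    have b: "ess_bounded M (j (\<Sum>i<n. a i *\<^sub>R y i))"
    proof -
      obtain C where C: "\<And>i. AE \<omega> in M. \<bar>j (y i) \<omega>\<bar> \<le> C i" using bdd unfolding ess_bounded_def by metis
      have "AE \<omega> in M. \<forall>i. \<bar>j (y i) \<omega>\<bar> \<le> C i" unfolding AE_all_countable using C by simp
      then have "AE \<omega> in M. \<bar>j (\<Sum>i<n. a i *\<^sub>R y i) \<omega>\<bar> \<le> (\<Sum>i<n. \<bar>a i\<bar> * C i)"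
        using j_sum[of "{..<n}" a y, simplified]
      proof eventually_elim
        case (elim \<omega>)
        have "\<bar>\<Sum>i<n. a i * j (y i) \<omega>\<bar> \<le> (\<Sum>i<n. \<bar>a i * j (y i) \<omega>\<bar>)" by (rule sum_abs)
        also have "\<dots> \<le> (\<Sum>i<n. \<bar>a i\<bar> * C i)"
          using elim by (intro sum_mono) (auto simp: abs_mult intro!: mult_left_mono)
        finally show ?case using elim by simp
      qed
      then show ?thesis unfolding ess_bounded_def by blast
    qed
    have b': "ess_bounded M (j (a k *\<^sub>R y k))"
    proof -
      obtain C where C: "AE \<omega> in M. \<bar>j (y k) \<omega>\<bar> \<le> C" using bdd[of k] unfolding ess_bounded_def by blast
      have "AE \<omega> in M. \<bar>j (a k *\<^sub>R y k) \<omega>\<bar> \<le> \<bar>a k\<bar> * C"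
        using C j_scaleR[of "a k" "y k"] by eventually_elim (auto simp: abs_mult intro!: mult_left_mono)
      then show ?thesis unfolding ess_bounded_def by blast
    qed
    have "AE \<omega> in M. \<bar>j (a k *\<^sub>R y k) \<omega>\<bar> \<le> \<bar>j (\<Sum>i<n. a i *\<^sub>R y i) \<omega>\<bar>"
      using comb[OF that, of a] j_scaleR[of "a k" "y k"] by eventually_elim auto
    from norm_mono_ess_bounded[OF b' b this]
    have "\<bar>a k\<bar> * norm (y k) \<le> norm (\<Sum>i<n. a i *\<^sub>R y i)" by simp
    moreover have "\<bar>a k\<bar> * (1/2) \<le> \<bar>a k\<bar> * norm (y k)" using lower by (intro mult_left_mono) auto
    ultimately show ?thesis by simp
  qed
  \<comment> \<open>With coefficients at most \<open>2 * norm u\<close>, the terms beyond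
    \<open>N\<close> contribute at most \<open>c / 2 * norm u\<close> to \<open>T u\<close>, half of
    what the lower bound on \<open>Z\<close> demands.\<close>
  obtain N where N: "\<And>m n. N \<le> m \<Longrightarrow> norm (\<Sum>i=m..<n. norm (T (y i))) < c / 4"
    using summ[unfolded summable_Cauchy, rule_format, of "c / 4"] c(1) by auto
  \<comment> \<open>Infinite dimension leaves room for a non-zero vector whose first
    \<open>N\<close> coefficients vanish.\<close>
  have "\<exists>z\<in>Z. (\<forall>i<N. \<kappa> i z = 0) \<and> z \<noteq> 0"
    using finite_dimensional_if_functionals_separate[of \<kappa> Z N, OF lin Z(1)] inf by blast
  then obtain z where z: "z \<in> Z" "\<And>i. i < N \<Longrightarrow> \<kappa> i z = 0" "z \<noteq> 0" by blast
  define R where "R = (\<Sum>i<N. K / L1_norm M (j (y i)) * norm (T (y i)))"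
  have "0 \<le> R" unfolding R_def using K(1) less_imp_le[OF pos] by (intro sum_nonneg) simp
  \<comment> \<open>\<open>Q\<close> collects the three losses per unit of approximation error
    \<open>s\<close>: \<open>norm T\<close> from \<open>T (z - u)\<close>, \<open>R\<close> from the
    first \<open>N\<close> coefficients of \<open>u\<close>, and \<open>c / 2\<close> from comparing
    \<open>norm u\<close> with \<open>norm z\<close>.\<close>
  define Q where "Q = norm T + R + c / 2"
  have Q: "0 < Q" unfolding Q_def using c(1) \<open>0 \<le> R\<close> by (simp add: add_nonneg_pos)
  have "norm (T z) \<le> c / 2 * norm z + e" if e: "e > 0" for e
  proof -
    define s where "s = e / Q"
    have s: "s > 0" "e = s * Q" using e Q by (simp_all add: s_def)
    have "z \<in> closure (span (range y))" using z(1) Z(3) by blast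
    then obtain u where u: "u \<in> span (range y)" "norm (u - z) < s"
      unfolding closure_approachable dist_norm using s(1) by blast
    obtain n0 a where n0: "\<And>m. m \<ge> n0 \<Longrightarrow> u = (\<Sum>i<m. a i *\<^sub>R y i)"
      using span_range_eq_sum[OF u(1)] by blast
    define n where "n = max N n0"
    have n: "N \<le> n" "u = (\<Sum>i<n. a i *\<^sub>R y i)" using n0[of n] by (simp_all add: n_def)
    have small: "\<bar>a i\<bar> \<le> K / L1_norm M (j (y i)) * s" if "i < N" for i
    proof -
      have "\<bar>a i\<bar> = \<bar>\<kappa> i (u - z)\<bar>"
        using coeff[of i n a] that n z(2)[OF that] by (simp add: linear_diff[OF lin])
      also have "\<dots> \<le> K / L1_norm M (j (y i)) * norm (u - z)" by (rule \<kappa>_le)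
      also have "\<dots> \<le> K / L1_norm M (j (y i)) * s"
        using u(2) K(1) pos[of i] by (intro mult_left_mono) auto
      finally show ?thesis .
    qed
    have "norm (T u) \<le> (\<Sum>i<n. \<bar>a i\<bar> * norm (T (y i)))"
      unfolding n(2) blinfun.sum_right blinfun.scaleR_right
      by (rule order.trans[OF norm_sum]) simp
    also have "\<dots> = (\<Sum>i<N. \<bar>a i\<bar> * norm (T (y i))) + (\<Sum>i=N..<n. \<bar>a i\<bar> * norm (T (y i)))"
      using sum.atLeastLessThan_concat[OF le0 n(1), of "\<lambda>i. \<bar>a i\<bar> * norm (T (y i))"]
      by (simp add: lessThan_atLeast0)
    also have "\<dots> \<le> (\<Sum>i<N. K / L1_norm M (j (y i)) * s * norm (T (y i)))
        + (\<Sum>i=N..<n. 2 * norm u * norm (T (y i)))"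
      using small coeff_le[of _ n a] n(2) by (intro add_mono sum_mono mult_right_mono) auto
    also have "(\<Sum>i<N. K / L1_norm M (j (y i)) * s * norm (T (y i)))
        = s * R"
      by (simp add: R_def sum_distrib_left mult_ac)
    also have "(\<Sum>i=N..<n. 2 * norm u * norm (T (y i))) = 2 * norm u * (\<Sum>i=N..<n. norm (T (y i)))"
      by (simp add: sum_distrib_left)
    also have "\<dots> \<le> 2 * norm u * (c / 4)" using N[of N n] by (intro mult_left_mono) auto
    also have "\<dots> \<le> c / 2 * (norm z + s)"
    proof -
      have "norm u \<le> norm z + s" using u(2) norm_triangle_sub[of u z] by simp
      then show ?thesis using c(1) mult_left_mono[of "norm u" "norm z + s" "c / 2"] by simp
    qed
    finally have Tu: "norm (T u) \<le> s * R + c / 2 * (norm z + s)" by simp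
    have "norm (T z) \<le> norm (T u) + norm (T (z - u))"
      using norm_triangle_sub[of "T z" "T u"] by (simp add: blinfun.diff_right)
    also have "norm (T (z - u)) \<le> norm T * s"
      using norm_blinfun[of T "z - u"] u(2) mult_left_mono[of "norm (z - u)" "s" "norm T"]
      by (simp add: norm_minus_commute)
    finally have "norm (T z) \<le> s * R + c / 2 * (norm z + s) + norm T * s" using Tu by linarith
    also have "\<dots> = c / 2 * norm z + s * Q" unfolding Q_def by (simp add: algebra_simps)
    finally show ?thesis using s(2) by simp
  qed
  then have "norm (T z) \<le> c / 2 * norm z" by (rule field_le_epsilon)
  moreover have "c * norm z \<le> norm (T z)" by (rule c(2)[OF z(1)])
  moreover have "0 < c * norm z" using c(1) z(3) by simp
  ultimately show False by simp
qed

text \<open>Gliding hump: cutting each \<open>x n\<close> down to the set where it is not small, minus the corresponding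
  sets of all later members of a sparse subsequence, changes it by little in norm.\<close>
lemma disjoint_sequence_approximation:
  assumes bdd: "\<And>n. ess_bounded M (j (x n))"
    and small: "\<And>n. prob {\<omega> \<in> space M. \<bar>j (x n) \<omega>\<bar> > (1/2)^n} < (1/2)^n"
  shows "\<exists>s y. strict_mono s \<and> (\<forall>k. ess_bounded M (j (y k)))
    \<and> (\<forall>n m. n \<noteq> m \<longrightarrow> (AE \<omega> in M. j (y n) \<omega> = 0 \<or> j (y m) \<omega> = 0))
    \<and> (\<forall>k::nat. norm (x (s k) - y k) \<le> 3 * (1/2)^k)"
proof -
  define B where "B n = {\<omega> \<in> space M. \<bar>j (x n) \<omega>\<bar> > (1/2)^n}" for n
  have B [measurable]: "B n \<in> sets M" for n unfolding B_def by measurable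
  define U where "U k = (\<Union>i\<in>{k..}. B i)" for k
  have U [measurable]: "U k \<in> sets M" for k unfolding U_def by measurable
  have "decseq U" unfolding decseq_def U_def by fastforce
  \<comment> \<open>Borel-Cantelli: almost every point lies in only finitely many of the sets
    \<open>B n\<close>.\<close>
  have lim: "AE \<omega> in M. \<exists>k. \<omega> \<notin> U k"
  proof -
    have "summable (\<lambda>n. prob (B n))"
      by (rule summable_comparison_test'[of "\<lambda>n. (1/2)^n" 0])
        (use small in \<open>auto simp: B_def less_imp_le\<close>)
    then have "AE \<omega> in M. eventually (\<lambda>n. \<omega> \<in> space M - B n) sequentially"
      by (intro borel_cantelli_AE1) (auto simp: emeasure_eq_measure)
    then show ?thesis
      by eventually_elim (auto simp: eventually_sequentially U_def)
  qed
  have "\<exists>z. AE \<omega> in M. j z \<omega> = indicator (U k) \<omega>" for k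
    by (rule ess_bounded_in_range) (auto simp: ess_bounded_def indicator_def intro!: exI[of _ 1])
  then obtain u where u: "\<And>k. AE \<omega> in M. j (u k) \<omega> = indicator (U k) \<omega>" by metis
  obtain C0 where C0: "\<And>n. AE \<omega> in M. \<bar>j (x n) \<omega>\<bar> \<le> C0 n" using bdd unfolding ess_bounded_def by metis
  define C where "C n = max 1 (C0 n)" for n
  have C: "AE \<omega> in M. \<bar>j (x n) \<omega>\<bar> \<le> C n" "C n \<ge> 1" for n
    using C0[of n] by (auto simp: C_def elim!: eventually_mono)
  \<comment> \<open>The next index is taken so late that the part of \<open>x (s k)\<close> on
    \<open>U (s (Suc k))\<close>, dominated by \<open>C (s k)\<close> times the indicator, has norm
    at most \<open>(1/2)^k\<close>. Taking the maximum with 1 in \<open>C\<close> makes the division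
    harmless.\<close>
  have "\<exists>s. \<forall>k. True \<and> (s k < s (Suc k) \<and> norm (u (s (Suc k))) < (1/2)^k / C (s k))"
  proof (rule dependent_nat_choice)
    fix n k :: nat
    have "(1/2)^k / C n > 0" using C(2)[of n] by simp
    then obtain l where l: "\<And>i. i \<ge> l \<Longrightarrow> norm (u i) < (1/2)^k / C n"
      using norm_indicator_vanishes[OF u \<open>decseq U\<close> lim] by blast
    show "\<exists>m. True \<and> (n < m \<and> norm (u m) < (1/2)^k / C n)"
      using l[of "max l (Suc n)"] by (intro exI[of _ "max l (Suc n)"]) auto
  qed simp
  then obtain s where s: "\<And>k. s k < s (Suc k)" "\<And>k. norm (u (s (Suc k))) < (1/2)^k / C (s k)" by blast
  have mono: "strict_mono s" using s(1) by (simp add: strict_mono_Suc_iff)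
  define A where "A k = B (s k) - U (s (Suc k))" for k
  have A [measurable]: "A k \<in> sets M" for k unfolding A_def by measurable
  have disjA: "A k \<inter> A l = {}" if "k < l" for k l
  proof -
    have "s (Suc k) \<le> s l" using that by (simp add: strict_mono_less_eq[OF mono])
    then have "B (s l) \<subseteq> U (s (Suc k))" by (auto simp: U_def)
    then show ?thesis by (auto simp: A_def)
  qed
  have "\<exists>z. AE \<omega> in M. j z \<omega> = j (x (s k)) \<omega> * indicator (A k) \<omega>" for k
  proof (rule ess_bounded_in_range)
    have "AE \<omega> in M. \<bar>j (x (s k)) \<omega> * indicator (A k) \<omega>\<bar> \<le> C (s k)"
      using C(1)[of "s k"]
    proof eventually_elim
      case (elim \<omega>)
      then show ?case using C(2)[of "s k"] by (simp add: indicator_def)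
    qed
    then show "ess_bounded M (\<lambda>\<omega>. j (x (s k)) \<omega> * indicator (A k) \<omega>)"
      unfolding ess_bounded_def by blast
  qed measurable
  then obtain y where y: "\<And>k. AE \<omega> in M. j (y k) \<omega> = j (x (s k)) \<omega> * indicator (A k) \<omega>" by metis
  have "ess_bounded M (j (y k))" for k
  proof -
    have "AE \<omega> in M. \<bar>j (y k) \<omega>\<bar> \<le> C (s k)"
      using C(1)[of "s k"] y[of k]
    proof eventually_elim
      case (elim \<omega>)
      then show ?case using C(2)[of "s k"] by (simp add: indicator_def)
    qed
    then show ?thesis unfolding ess_bounded_def by blast
  qed
  moreover have "AE \<omega> in M. j (y n) \<omega> = 0 \<or> j (y m) \<omega> = 0" if "n \<noteq> m" for n m
    using y[of n] y[of m]
  proof eventually_elim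
    case (elim \<omega>)
    have "A n \<inter> A m = {}" using disjA[of n m] disjA[of m n] that by (cases "n < m") auto
    then show ?case using elim by (auto simp: indicator_def)
  qed
  moreover have "norm (x (s k) - y k) \<le> 3 * (1/2)^k" for k
  proof -
    let ?v = "C (s k) *\<^sub>R u (s (Suc k))"
    \<comment> \<open>The difference splits into \<open>w\<close>, the part on
      \<open>U (s (Suc k))\<close>, and a remainder that lives outside \<open>B (s k)\<close>. They
      contribute once and twice \<open>(1/2)^k\<close>, the factor two coming from
      \<open>norm_le_ess_bound\<close>.\<close>
    have "AE \<omega> in M. \<bar>j (x (s k) - y k - w) \<omega>\<bar> \<le> (1/2)^(s k)"
      if w: "AE \<omega> in M. j w \<omega> = j (x (s k)) \<omega> * indicator (U (s (Suc k))) \<omega>" for w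
      using w y[of k] j_diff[of "x (s k)" "y k"] j_diff[of "x (s k) - y k" w] AE_space
    proof eventually_elim
      case (elim \<omega>)
      show ?case
      proof (cases "\<omega> \<in> B (s k) \<or> \<omega> \<in> U (s (Suc k))")
        case True
        then show ?thesis using elim by (auto simp: A_def indicator_def)
      next
        case False
        then show ?thesis using elim by (auto simp: A_def indicator_def B_def)
      qed
    qed
    moreover have "\<exists>w. AE \<omega> in M. j w \<omega> = j (x (s k)) \<omega> * indicator (U (s (Suc k))) \<omega>"
    proof (rule ess_bounded_in_range)
      have "AE \<omega> in M. \<bar>j (x (s k)) \<omega> * indicator (U (s (Suc k))) \<omega>\<bar> \<le> C (s k)"
        using C(1)[of "s k"]
      proof eventually_elim
        case (elim \<omega>)
        then show ?case using C(2)[of "s k"] by (simp add: indicator_def)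
      qed
      then show "ess_bounded M (\<lambda>\<omega>. j (x (s k)) \<omega> * indicator (U (s (Suc k))) \<omega>)"
        unfolding ess_bounded_def by blast
    qed measurable
    ultimately obtain w where w: "AE \<omega> in M. j w \<omega> = j (x (s k)) \<omega> * indicator (U (s (Suc k))) \<omega>"
      and rest: "AE \<omega> in M. \<bar>j (x (s k) - y k - w) \<omega>\<bar> \<le> (1/2)^(s k)" by blast
    have "norm w \<le> norm ?v"
    proof (rule norm_mono_ess_bounded)
      have *: "AE \<omega> in M. \<bar>j w \<omega>\<bar> \<le> \<bar>j ?v \<omega>\<bar> \<and> \<bar>j ?v \<omega>\<bar> \<le> C (s k)"
        using w C(1)[of "s k"] u[of "s (Suc k)"] j_scaleR[of "C (s k)" "u (s (Suc k))"]
      proof eventually_elim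
        case (elim \<omega>)
        then show ?case using C(2)[of "s k"] by (auto simp: indicator_def)
      qed
      then show "AE \<omega> in M. \<bar>j w \<omega>\<bar> \<le> \<bar>j ?v \<omega>\<bar>" by eventually_elim simp
      have "AE \<omega> in M. \<bar>j w \<omega>\<bar> \<le> C (s k)" using * by eventually_elim simp
      then show "ess_bounded M (j w)" unfolding ess_bounded_def by blast
      have "AE \<omega> in M. \<bar>j ?v \<omega>\<bar> \<le> C (s k)" using * by eventually_elim simp
      then show "ess_bounded M (j ?v)" unfolding ess_bounded_def by blast
    qed
    also have "\<dots> \<le> (1/2)^k" using s(2)[of k] C(2)[of "s k"] by (simp add: field_simps)
    finally have "norm w \<le> (1/2)^k" .
    moreover have "norm (x (s k) - y k - w) \<le> 2 * (1/2)^(s k)" by (rule norm_le_ess_bound[OF rest])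
    moreover have "(1/2::real)^(s k) \<le> (1/2)^k"
      using strict_mono_imp_increasing[OF mono, of k] by (intro power_decreasing) auto
    moreover have "norm (x (s k) - y k) \<le> norm (x (s k) - y k - w) + norm w"
      by (rule norm_triangle_sub[of "x (s k) - y k" w, unfolded add.commute[of "norm w"]])
    ultimately show ?thesis by linarith
  qed
  ultimately show ?thesis using mono by blast
qed

text \<open>Failure of the estimate is used with the same small number for both constants. The
  vectors obtained are normalised, replaced by bounded ones and made disjoint, which contradicts
  \<open>DNS T\<close>.\<close>

lemma DNS_bounded_below_near_zero_in_measure:
  fixes T :: "'a \<Rightarrow>\<^sub>L 'b::banach"
  assumes "DNS T"
  shows "\<exists>r>0. \<exists>\<delta>>0. \<forall>x. prob {\<omega> \<in> space M. \<bar>j x \<omega>\<bar> > \<delta> * norm x} < \<delta> \<longrightarrow> r * norm x \<le> norm (T x)"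
proof (rule ccontr)
  assume neg: "\<not> ?thesis"
  obtain K where K: "K > 0" "\<And>x. L1_norm M (j x) \<le> K * norm x" using j_L1_bound by blast
  have "\<exists>x. ess_bounded M (j x) \<and> 3/4 \<le> norm x \<and> norm (T x) < (1/2)^n
      \<and> prob {\<omega> \<in> space M. \<bar>j x \<omega>\<bar> > (1/2)^n} < (1/2)^n" for n :: nat
  proof -
    \<comment> \<open>Half of \<open>(1/2)^n\<close>: the other half pays for passing from
      \<open>v\<close> to the bounded element \<open>z\<close>.\<close>
    define e :: real where "e = (1/2)^n / 2"
    have e: "e > 0" by (simp add: e_def)
    obtain x where x: "prob {\<omega> \<in> space M. \<bar>j x \<omega>\<bar> > e * norm x} < e" "norm (T x) < e * norm x"
      using neg e by (meson not_le)
    have x0: "x \<noteq> 0" using x(2) by auto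
    define v where "v = (1 / norm x) *\<^sub>R x"
    have v: "norm v = 1" using x0 by (simp add: v_def)
    have "\<bar>1 / norm x\<bar> * norm (T x) < e"
      using x(2) x0 by (simp add: field_simps)
    then have Tv: "norm (T v) < e" by (simp add: v_def blinfun.scaleR_right)
    \<comment> \<open>The three bounds keep \<open>norm z\<close> above \<open>3/4\<close>, make the
      change under \<open>T\<close> at most \<open>e\<close>, and bound the probability in Markov's
      inequality for \<open>v - z\<close> by \<open>e\<close>.\<close>
    define h where "h = min (1/4) (min (e / (norm T + 1)) (e * e / (2 * K)))"
    have h: "h \<le> 1/4" "h \<le> e / (norm T + 1)" "h \<le> e * e / (2 * K)"
      unfolding h_def by linarith+
    have "h > 0" using e K(1) by (simp add: h_def add_nonneg_pos)
    obtain z where z: "ess_bounded M (j z)" "norm (v - z) < h" using dense_ess_bounded[OF \<open>h > 0\<close>] by blast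
    have "3/4 \<le> norm z" using z(2) h(1) v norm_triangle_ineq2[of v z] by simp
    moreover have "norm (T z) < (1/2)^n"
    proof -
      have "norm (T z) \<le> norm (T v) + norm (T (v - z))"
        using norm_triangle_sub[of "T z" "T v"] by (simp add: blinfun.diff_right norm_minus_commute)
      also have "norm (T (v - z)) \<le> (norm T + 1) * h"
        by (rule order.trans[OF norm_blinfun mult_mono]) (use z(2) in auto)
      also have "\<dots> \<le> e" using h(2) pos_le_divide_eq[of "norm T + 1" h e] by (simp add: add_nonneg_pos mult.commute)
      finally show ?thesis using Tv by (simp add: e_def)
    qed
    moreover have "prob {\<omega> \<in> space M. \<bar>j z \<omega>\<bar> > (1/2)^n} < (1/2)^n"
    proof -
      have "prob {\<omega> \<in> space M. \<bar>j z \<omega>\<bar> > (1/2)^n}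
          \<le> prob ({\<omega> \<in> space M. \<bar>j x \<omega>\<bar> > e * norm x} \<union> {\<omega> \<in> space M. \<bar>j (v - z) \<omega>\<bar> > e})"
      proof (rule finite_measure_mono_AE)
        show "AE \<omega> in M. \<omega> \<in> {\<omega> \<in> space M. \<bar>j z \<omega>\<bar> > (1/2)^n} \<longrightarrow>
            \<omega> \<in> {\<omega> \<in> space M. \<bar>j x \<omega>\<bar> > e * norm x} \<union> {\<omega> \<in> space M. \<bar>j (v - z) \<omega>\<bar> > e}"
          using j_diff[of v z] j_scaleR[of "1 / norm x" x]
        proof eventually_elim
          case (elim \<omega>)
          have "j x \<omega> = norm x * j v \<omega>" using elim x0 by (simp add: v_def)
          then have "\<bar>j x \<omega>\<bar> > e * norm x \<longleftrightarrow> \<bar>j v \<omega>\<bar> > e"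
            using x0 by (simp add: abs_mult mult.commute)
          moreover have "\<bar>j v \<omega>\<bar> > e \<or> \<bar>j (v - z) \<omega>\<bar> > e" if "\<bar>j z \<omega>\<bar> > (1/2)^n"
            using that elim(1) unfolding e_def by linarith
          ultimately show ?case by blast
        qed
      qed measurable
      also have "\<dots> \<le> prob {\<omega> \<in> space M. \<bar>j x \<omega>\<bar> > e * norm x} + prob {\<omega> \<in> space M. \<bar>j (v - z) \<omega>\<bar> > e}"
        by (rule measure_Un_le) measurable
      also have "prob {\<omega> \<in> space M. \<bar>j (v - z) \<omega>\<bar> > e} \<le> K * norm (v - z) / e"
        using prob_abs_gt_le[OF j_integrable e, of "v - z"] K(2)[of "v - z"] e
        by (meson divide_right_mono less_imp_le order.trans)
      also have "\<dots> \<le> e"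
      proof -
        have "K * norm (v - z) \<le> K * (e * e / (2 * K))" using z(2) h(3) K(1) by (intro mult_left_mono) auto
        also have "\<dots> \<le> e * e" using K(1) e by simp
        finally show ?thesis using e by (simp add: field_simps)
      qed
      finally show ?thesis using x(1) by (simp add: e_def)
    qed
    ultimately show ?thesis using z(1) by blast
  qed
  then have "\<exists>x. \<forall>n. ess_bounded M (j (x n)) \<and> 3/4 \<le> norm (x n) \<and> norm (T (x n)) < (1/2)^n
      \<and> prob {\<omega> \<in> space M. \<bar>j (x n) \<omega>\<bar> > (1/2)^n} < (1/2)^n"
    by (intro choice allI)
  then obtain x where x: "\<And>n. ess_bounded M (j (x n))" "\<And>n. 3/4 \<le> norm (x n)"
      "\<And>n. norm (T (x n)) < (1/2)^n" "\<And>n. prob {\<omega> \<in> space M. \<bar>j (x n) \<omega>\<bar> > (1/2)^n} < (1/2)^n"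
    by blast
  obtain s y where s: "strict_mono s" and y: "\<And>k. ess_bounded M (j (y k))"
      "\<And>n m. n \<noteq> m \<Longrightarrow> AE \<omega> in M. j (y n) \<omega> = 0 \<or> j (y m) \<omega> = 0"
      "\<And>k::nat. norm (x (s k) - y k) \<le> 3 * (1/2)^k"
    using disjoint_sequence_approximation[OF x(1) x(4)] by blast
  \<comment> \<open>After dropping four terms the error \<open>3 * (1/2)^(k+4)\<close> is at most
    \<open>1/4\<close>, so the norms stay above \<open>1/2\<close>.\<close>
  define y' where "y' k = y (k + 4)" for k
  have lower: "1/2 \<le> norm (y' k)" for k
  proof -
    have "(1/2::real)^(k+4) \<le> (1/2)^4" by (rule power_decreasing) auto
    then have "3 * (1/2::real)^(k+4) \<le> 1/4" by (simp add: power_divide)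
    then show ?thesis
      using x(2)[of "s (k + 4)"] y(3)[of "k + 4"] norm_triangle_ineq2[of "x (s (k + 4))" "y (k + 4)"]
      unfolding y'_def by linarith
  qed
  have bound: "norm (T (y' k)) \<le> (1 + 3 * norm T) * (1/2)^k" for k
  proof -
    have le: "(1/2::real)^(s (k+4)) \<le> (1/2)^k" "(1/2::real)^(k+4) \<le> (1/2)^k"
      using strict_mono_imp_increasing[OF s, of "k + 4"] by (auto intro!: power_decreasing)
    have "norm (T (y' k)) \<le> norm (T (x (s (k+4)))) + norm (T (x (s (k+4)) - y (k+4)))"
      using norm_triangle_sub[of "T (y (k+4))" "T (x (s (k+4)))"]
      by (simp add: y'_def blinfun.diff_right norm_minus_commute)
    also have "norm (T (x (s (k+4)) - y (k+4))) \<le> norm T * (3 * (1/2)^(k+4))"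
      by (rule order.trans[OF norm_blinfun mult_left_mono]) (use y(3) in auto)
    also have "\<dots> \<le> norm T * (3 * (1/2)^k)" using le(2) by (intro mult_left_mono) auto
    finally have "norm (T (y' k)) \<le> (1/2)^k + norm T * (3 * (1/2)^k)"
      using x(3)[of "s (k+4)"] le(1) by linarith
    then show ?thesis by (simp add: algebra_simps)
  qed
  have "summable (\<lambda>n. norm (T (y' n)))"
    by (rule summable_comparison_test'[of "\<lambda>n. (1 + 3 * norm T) * (1/2)^n" 0])
      (use bound in \<open>auto intro!: summable_mult\<close>)
  then have "strictly_singular_on (blinfun_apply T) (closure (span (range y')))"
    by (intro strictly_singular_on_disjoint_span) (use y lower in \<open>auto simp: y'_def\<close>)
  moreover have "disjoint_seq y'"
    unfolding disjoint_seq_def y'_def using y by (auto intro!: inf_labs_eq_zero)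
  moreover have "y' n \<noteq> 0" for n using lower[of n] by auto
  ultimately show False using assms unfolding DNS_def by blast
qed

end

section \<open>The operator induced on the residual quotients\<close>

text \<open>Cauchy-Schwarz for the vectors \<open>(1, a)\<close> and \<open>(1, b)\<close>:
  \<open>(p * q)\<^sup>2\<close> exceeds \<open>(1 + a * b)\<^sup>2\<close> by exactly
  \<open>(a - b)\<^sup>2\<close>.\<close>

lemma sqrt_midpoint_convex:
  fixes a b :: real
  shows "sqrt (1 + ((a + b) / 2)\<^sup>2) \<le> (sqrt (1 + a\<^sup>2) + sqrt (1 + b\<^sup>2)) / 2"
    and "a \<noteq> b \<Longrightarrow> sqrt (1 + ((a + b) / 2)\<^sup>2) < (sqrt (1 + a\<^sup>2) + sqrt (1 + b\<^sup>2)) / 2"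
proof -
  define p q where "p = sqrt (1 + a\<^sup>2)" and "q = sqrt (1 + b\<^sup>2)"
  have p: "p > 0" "p\<^sup>2 = 1 + a\<^sup>2" by (simp_all add: p_def add_pos_nonneg)
  have q: "q > 0" "q\<^sup>2 = 1 + b\<^sup>2" by (simp_all add: q_def add_pos_nonneg)
  have sq: "(p * q)\<^sup>2 = (1 + a * b)\<^sup>2 + (a - b)\<^sup>2"
    unfolding power_mult_distrib p(2) q(2) by (simp add: power2_eq_square algebra_simps)
  have pq: "((p + q) / 2)\<^sup>2 = (1 + ((a + b) / 2)\<^sup>2) + (p * q - (1 + a * b)) / 2"
    using p(2) q(2) by (simp add: power2_eq_square field_simps)
  have "1 + a * b \<le> p * q"
    by (rule power2_le_imp_le) (use sq p(1) q(1) in simp_all)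
  then have "1 + ((a + b) / 2)\<^sup>2 \<le> ((p + q) / 2)\<^sup>2" unfolding pq by simp
  then have "sqrt (1 + ((a + b) / 2)\<^sup>2) \<le> (p + q) / 2"
    by (rule real_le_lsqrt[rotated]) (use p(1) q(1) in simp)
  then show "sqrt (1 + ((a + b) / 2)\<^sup>2) \<le> (sqrt (1 + a\<^sup>2) + sqrt (1 + b\<^sup>2)) / 2"
    by (simp add: p_def q_def)
  assume "a \<noteq> b"
  then have "0 < (a - b)\<^sup>2" by simp
  have "1 + a * b < p * q"
    by (rule power2_less_imp_less) (use sq p(1) q(1) \<open>0 < (a - b)\<^sup>2\<close> in simp_all)
  then have "1 + ((a + b) / 2)\<^sup>2 < ((p + q) / 2)\<^sup>2" unfolding pq by simp
  then have "sqrt (1 + ((a + b) / 2)\<^sup>2) < (p + q) / 2"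
    by (rule real_less_lsqrt[rotated]) (use p(1) q(1) in simp)
  then show "sqrt (1 + ((a + b) / 2)\<^sup>2) < (sqrt (1 + a\<^sup>2) + sqrt (1 + b\<^sup>2)) / 2"
    by (simp add: p_def q_def)
qed

text \<open>Strict convexity becomes uniform on the compact square with a neighbourhood of the
  diagonal removed, where the continuous gap attains a positive minimum.\<close>

lemma sqrt_midpoint_gap:
  assumes \<tau>: "0 < \<tau>"
  shows "\<exists>\<kappa>>0. \<forall>a b::real. \<bar>a\<bar> \<le> L \<longrightarrow> \<bar>b\<bar> \<le> L \<longrightarrow> \<tau> \<le> \<bar>a - b\<bar> \<longrightarrow>
    \<kappa> \<le> (sqrt (1 + a\<^sup>2) + sqrt (1 + b\<^sup>2)) / 2 - sqrt (1 + ((a + b) / 2)\<^sup>2)"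
proof -
  define G :: "real \<times> real \<Rightarrow> real" where
    "G p = (sqrt (1 + (fst p)\<^sup>2) + sqrt (1 + (snd p)\<^sup>2)) / 2 - sqrt (1 + ((fst p + snd p) / 2)\<^sup>2)" for p
  define S :: "(real \<times> real) set" where "S = ({-L..L} \<times> {-L..L}) \<inter> {p. \<tau> \<le> \<bar>fst p - snd p\<bar>}"
  have mem: "(a, b) \<in> S \<longleftrightarrow> \<bar>a\<bar> \<le> L \<and> \<bar>b\<bar> \<le> L \<and> \<tau> \<le> \<bar>a - b\<bar>" for a b
    by (auto simp: S_def abs_le_iff)
  have "compact S" unfolding S_def
    by (intro compact_Int_closed compact_Times compact_Icc closed_Collect_le continuous_intros)
  have cont: "continuous_on S G" unfolding G_def by (intro continuous_intros) auto
  show ?thesis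
  proof (cases "S = {}")
    case True
    then show ?thesis using mem by (intro exI[of _ 1]) simp
  next
    case False
    obtain p where p: "p \<in> S" "\<And>q. q \<in> S \<Longrightarrow> G p \<le> G q"
      using continuous_attains_inf[OF \<open>compact S\<close> False cont] by blast
    have "fst p \<noteq> snd p" using p(1) \<tau> by (auto simp: S_def)
    then have "0 < G p" using sqrt_midpoint_convex(2)[of "fst p" "snd p"] by (simp add: G_def)
    moreover have "G p \<le> (sqrt (1 + a\<^sup>2) + sqrt (1 + b\<^sup>2)) / 2 - sqrt (1 + ((a + b) / 2)\<^sup>2)"
      if "\<bar>a\<bar> \<le> L" "\<bar>b\<bar> \<le> L" "\<tau> \<le> \<bar>a - b\<bar>" for a b
      using p(2)[of "(a, b)"] that mem unfolding G_def[of "(a, b)"] by simp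
    ultimately show ?thesis by blast
  qed
qed

lemma integrable_sqrt_one_plus_square:
  assumes "finite_measure M" "integrable M f"
  shows "integrable M (\<lambda>\<omega>. sqrt (1 + (f \<omega>)\<^sup>2))"
proof -
  interpret finite_measure M by fact
  show ?thesis
  proof (rule Bochner_Integration.integrable_bound[of M "\<lambda>\<omega>. 1 + \<bar>f \<omega>\<bar>"])
    show "integrable M (\<lambda>\<omega>. 1 + \<bar>f \<omega>\<bar>)" using assms(2) by simp
    show "AE \<omega> in M. norm (sqrt (1 + (f \<omega>)\<^sup>2)) \<le> norm (1 + \<bar>f \<omega>\<bar>)"
    proof (rule AE_I2)
      fix \<omega>
      have "sqrt (1 + (f \<omega>)\<^sup>2) \<le> sqrt 1 + sqrt ((f \<omega>)\<^sup>2)" by (rule sqrt_add_le_add_sqrt) auto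
      then show "norm (sqrt (1 + (f \<omega>)\<^sup>2)) \<le> norm (1 + \<bar>f \<omega>\<bar>)" by simp
    qed
    have [measurable]: "f \<in> borel_measurable M" using assms(2) by simp
    show "(\<lambda>\<omega>. sqrt (1 + (f \<omega>)\<^sup>2)) \<in> borel_measurable M" by measurable
  qed
qed

text \<open>Where both functions are bounded by \<open>L\<close> and differ by more than \<tau>, the
  midpoint gap is at least \<kappa>. A small integral of the gap makes this rare, and Markov's
  inequality makes values beyond \<open>L\<close> rare.\<close>

lemma (in prob_space) near_minimisers_close_in_measure:
  assumes \<tau>: "0 < \<tau>" and D: "0 \<le> D"
  shows "\<exists>\<eta>>0. \<forall>f g. integrable M f \<longrightarrow> integrable M g \<longrightarrow> L1_norm M f \<le> D \<longrightarrow> L1_norm M g \<le> D \<longrightarrow>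
    ((\<integral>\<omega>. sqrt (1 + (f \<omega>)\<^sup>2) \<partial>M) + (\<integral>\<omega>. sqrt (1 + (g \<omega>)\<^sup>2) \<partial>M)) / 2
      - (\<integral>\<omega>. sqrt (1 + ((f \<omega> + g \<omega>) / 2)\<^sup>2) \<partial>M) \<le> \<eta> \<longrightarrow>
    prob {\<omega> \<in> space M. \<bar>f \<omega> - g \<omega>\<bar> > \<tau>} < \<tau>"
proof -
  \<comment> \<open>With this \<open>L\<close> and the gap bound
    \<open>\<kappa> * (\<tau> / 4)\<close>, each of the three exceptional sets has probability at
    most \<open>\<tau> / 4\<close>.\<close>
  define L where "L = 4 * D / \<tau> + 1"
  have L: "L > 0" using \<tau> D by (simp add: L_def add_nonneg_pos)
  have DL: "D / L < \<tau> / 4" using L \<tau> D by (simp add: L_def field_simps)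
  obtain \<kappa> where \<kappa>: "\<kappa> > 0" "\<And>a b. \<bar>a\<bar> \<le> L \<Longrightarrow> \<bar>b\<bar> \<le> L \<Longrightarrow> \<tau> \<le> \<bar>a - b\<bar> \<Longrightarrow>
      \<kappa> \<le> (sqrt (1 + a\<^sup>2) + sqrt (1 + b\<^sup>2)) / 2 - sqrt (1 + ((a + b) / 2)\<^sup>2)"
    using sqrt_midpoint_gap[OF \<tau>, of L] by metis
  have "prob {\<omega> \<in> space M. \<bar>f \<omega> - g \<omega>\<bar> > \<tau>} < \<tau>"
    if f: "integrable M f" "L1_norm M f \<le> D" and g: "integrable M g" "L1_norm M g \<le> D"
      and gap: "((\<integral>\<omega>. sqrt (1 + (f \<omega>)\<^sup>2) \<partial>M) + (\<integral>\<omega>. sqrt (1 + (g \<omega>)\<^sup>2) \<partial>M)) / 2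
        - (\<integral>\<omega>. sqrt (1 + ((f \<omega> + g \<omega>) / 2)\<^sup>2) \<partial>M) \<le> \<kappa> * (\<tau> / 4)" for f g
  proof -
    have [measurable]: "f \<in> borel_measurable M" "g \<in> borel_measurable M" using f(1) g(1) by auto
    define d where "d \<omega> = (sqrt (1 + (f \<omega>)\<^sup>2) + sqrt (1 + (g \<omega>)\<^sup>2)) / 2 - sqrt (1 + ((f \<omega> + g \<omega>) / 2)\<^sup>2)" for \<omega>
    note int = integrable_sqrt_one_plus_square[OF finite_measure_axioms]
    have ints: "integrable M (\<lambda>\<omega>. sqrt (1 + (f \<omega>)\<^sup>2))" "integrable M (\<lambda>\<omega>. sqrt (1 + (g \<omega>)\<^sup>2))"
        "integrable M (\<lambda>\<omega>. sqrt (1 + ((f \<omega> + g \<omega>) / 2)\<^sup>2))"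
      using f(1) g(1) by (auto intro!: int)
    have d_int: "integrable M d" unfolding d_def using ints by auto
    have d_nonneg: "0 \<le> d \<omega>" for \<omega> using sqrt_midpoint_convex(1)[of "f \<omega>" "g \<omega>"] by (simp add: d_def)
    have d_le: "(\<integral>\<omega>. d \<omega> \<partial>M) \<le> \<kappa> * (\<tau> / 4)" unfolding d_def using ints gap by simp
    let ?F = "{\<omega> \<in> space M. \<bar>f \<omega>\<bar> > L}" and ?G = "{\<omega> \<in> space M. \<bar>g \<omega>\<bar> > L}"
      and ?D = "{\<omega> \<in> space M. \<kappa> \<le> d \<omega>}"
    have [measurable]: "d \<in> borel_measurable M" using d_int by simp
    have markov: "prob {\<omega> \<in> space M. \<bar>h \<omega>\<bar> > L} \<le> D / L" if h: "integrable M h" "L1_norm M h \<le> D" for h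
      using prob_abs_gt_le[OF h(1) L] divide_right_mono[OF h(2), of L] L by simp
    have "prob ?D \<le> (\<integral>\<omega>. d \<omega> \<partial>M) / \<kappa>"
      by (rule integral_Markov_inequality_measure[where A = "space M"]) (use d_int d_nonneg \<kappa>(1) in auto)
    also have "\<dots> \<le> \<tau> / 4" using d_le \<kappa>(1) by (simp add: field_simps)
    finally have PD: "prob ?D \<le> \<tau> / 4" .
    have "prob {\<omega> \<in> space M. \<bar>f \<omega> - g \<omega>\<bar> > \<tau>} \<le> prob ((?F \<union> ?G) \<union> ?D)"
    proof (rule finite_measure_mono)
      show "{\<omega> \<in> space M. \<bar>f \<omega> - g \<omega>\<bar> > \<tau>} \<subseteq> (?F \<union> ?G) \<union> ?D"
      proof
        fix \<omega> assume \<omega>: "\<omega> \<in> {\<omega> \<in> space M. \<bar>f \<omega> - g \<omega>\<bar> > \<tau>}"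
        show "\<omega> \<in> (?F \<union> ?G) \<union> ?D"
        proof (cases "\<bar>f \<omega>\<bar> \<le> L \<and> \<bar>g \<omega>\<bar> \<le> L")
          case True
          then have "\<kappa> \<le> d \<omega>" using \<omega> unfolding d_def by (intro \<kappa>(2)) auto
          then show ?thesis using \<omega> by simp
        next
          case False
          then show ?thesis using \<omega> by auto
        qed
      qed
    qed measurable
    also have "\<dots> \<le> prob (?F \<union> ?G) + prob ?D" by (rule measure_Un_le) measurable
    also have "prob (?F \<union> ?G) \<le> prob ?F + prob ?G" by (rule measure_Un_le) measurable
    also have "prob ?F + prob ?G + prob ?D < \<tau>"
      using PD markov[OF f] markov[OF g] DL \<tau> by linarith
    finally show ?thesis by simp
  qed
  moreover have "0 < \<kappa> * (\<tau> / 4)" using \<kappa>(1) \<tau> by simp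
  ultimately show ?thesis by blast
qed

context L1_represented_lattice
begin

text \<open>Minimising the strictly convex functional \<open>\<Psi>\<close> along the weak* neighbourhoods of \<open>\<phi>\<close> plays the
  role of passing to convex combinations that converge in measure.\<close>
lemma bidual_element_near_lattice:
  fixes T :: "'a \<Rightarrow>\<^sub>L 'b::banach"
  assumes r: "0 < r" and \<delta>: "0 < \<delta>"
    and below: "\<And>x. prob {\<omega> \<in> space M. \<bar>j x \<omega>\<bar> > \<delta> * norm x} < \<delta> \<Longrightarrow> r * norm x \<le> norm (T x)"
    and d: "norm (bidual_op T \<phi> - bidual_emb y) < d"
  shows "\<exists>x. norm (\<phi> - bidual_emb x) \<le> 2 * d / r"
proof -
  obtain K where K: "K > 0" "\<And>x. L1_norm M (j x) \<le> K * norm x" using j_L1_bound by blast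
  have d0: "0 < d" using d by (rule le_less_trans[OF norm_ge_zero])
  define \<Psi> where "\<Psi> x = (\<integral>\<omega>. sqrt (1 + (j x \<omega>)\<^sup>2) \<partial>M)" for x
  \<comment> \<open>Convex traces of weak* neighbourhoods of \<phi>. Shrinking the neighbourhood can
    only raise the infimum \<open>I\<close> of \<Psi>, and \<open>S\<close> is the supremum of these
    infima.\<close>
  define V where "V F e = {x. norm x \<le> norm \<phi> \<and> norm (T x - y) < d \<and> (\<forall>f\<in>F. \<bar>blinfun_apply f x - \<phi> f\<bar> < e)}"
    for F :: "('a \<Rightarrow>\<^sub>L real) set" and e
  define \<N> where "\<N> = {(F :: ('a \<Rightarrow>\<^sub>L real) set, e :: real). finite F \<and> 0 < e}"
  define I where "I p = (INF x\<in>V (fst p) (snd p). \<Psi> x)" for p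
  have nonempty: "V F e \<noteq> {}" if "(F, e) \<in> \<N>" for F e
    using Helly_bidual_approximation_functionals[OF d, of F e] that by (auto simp: V_def \<N>_def)
  have \<Psi>_nonneg: "0 \<le> \<Psi> x" for x unfolding \<Psi>_def by simp
  have \<Psi>_bound: "\<Psi> x \<le> 1 + K * norm \<phi>" if "norm x \<le> norm \<phi>" for x
  proof -
    have "\<Psi> x \<le> (\<integral>\<omega>. 1 + \<bar>j x \<omega>\<bar> \<partial>M)"
      unfolding \<Psi>_def
    proof (rule integral_mono)
      show "integrable M (\<lambda>\<omega>. sqrt (1 + (j x \<omega>)\<^sup>2))"
        by (rule integrable_sqrt_one_plus_square[OF finite_measure_axioms j_integrable])
      show "integrable M (\<lambda>\<omega>. 1 + \<bar>j x \<omega>\<bar>)" by simp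
      fix \<omega>
      show "sqrt (1 + (j x \<omega>)\<^sup>2) \<le> 1 + \<bar>j x \<omega>\<bar>"
        using sqrt_add_le_add_sqrt[of 1 "(j x \<omega>)\<^sup>2"] by simp
    qed
    also have "\<dots> = 1 + L1_norm M (j x)" by (simp add: L1_norm_def prob_space)
    also have "\<dots> \<le> 1 + K * norm \<phi>" 
      using order.trans[OF K(2) mult_left_mono[OF that]] K(1) by simp
    finally show ?thesis .
  qed
  have bdd: "bdd_below (\<Psi> ` A)" for A by (rule bdd_belowI2[of _ 0]) (rule \<Psi>_nonneg)
  have I_le: "I (F, e) \<le> \<Psi> x" if "x \<in> V F e" for F e x
    unfolding I_def using that by (auto intro!: cINF_lower[OF bdd])
  have I_near: "\<exists>x\<in>V F e. \<Psi> x < I (F, e) + \<eta>" if "(F, e) \<in> \<N>" "0 < \<eta>" for F e \<eta>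
    using cINF_less_iff[OF nonempty[OF that(1)] bdd, of "I (F, e) + \<eta>"] that(2) by (auto simp: I_def)
  have I_bdd: "bdd_above (I ` \<N>)"
  proof (rule bdd_aboveI2)
    fix p assume "p \<in> \<N>"
    then obtain x where "x \<in> V (fst p) (snd p)" using nonempty[of "fst p" "snd p"] by auto
    then show "I p \<le> 1 + K * norm \<phi>"
      using I_le[of x "fst p" "snd p"] \<Psi>_bound[of x] by (auto simp: V_def)
  qed
  define S where "S = (SUP p\<in>\<N>. I p)"
  have I_le_S: "I p \<le> S" if "p \<in> \<N>" for p unfolding S_def by (rule cSUP_upper[OF that I_bdd])
  \<comment> \<open>With this \<tau>, if two vectors are \<tau>-close in measure but more than
    \<open>2 * d / r\<close> apart in norm, their difference satisfies the hypothesis of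
    \<open>below\<close>.\<close>
  define \<tau> where "\<tau> = min \<delta> (2 * d * \<delta> / r)"
  have \<tau>: "0 < \<tau>" "\<tau> \<le> \<delta>" "\<tau> \<le> 2 * d * \<delta> / r" using r \<delta> d0 by (simp_all add: \<tau>_def)
  obtain \<eta> where \<eta>: "\<eta> > 0" "\<And>f g. integrable M f \<Longrightarrow> integrable M g \<Longrightarrow>
      L1_norm M f \<le> K * norm \<phi> \<Longrightarrow> L1_norm M g \<le> K * norm \<phi> \<Longrightarrow>
      ((\<integral>\<omega>. sqrt (1 + (f \<omega>)\<^sup>2) \<partial>M) + (\<integral>\<omega>. sqrt (1 + (g \<omega>)\<^sup>2) \<partial>M)) / 2
        - (\<integral>\<omega>. sqrt (1 + ((f \<omega> + g \<omega>) / 2)\<^sup>2) \<partial>M) \<le> \<eta> \<Longrightarrow>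
      prob {\<omega> \<in> space M. \<bar>f \<omega> - g \<omega>\<bar> > \<tau>} < \<tau>"
  proof -
    have "0 \<le> K * norm \<phi>" using K(1) by simp
    from near_minimisers_close_in_measure[OF \<tau>(1) this] show ?thesis using that by blast
  qed
  have "({}, 1) \<in> \<N>" by (simp add: \<N>_def)
  then have "\<N> \<noteq> {}" by blast
  \<comment> \<open>Here the infimum is almost \<open>S\<close>, so passing to a smaller
    neighbourhood can raise it by less than \<open>\<eta> / 2\<close>.\<close>
  then obtain F0 e0 where F0: "(F0, e0) \<in> \<N>" "S - \<eta> / 2 < I (F0, e0)"
    using less_cSUP_iff[OF _ I_bdd, of "S - \<eta> / 2"] \<eta>(1) unfolding S_def[symmetric] by auto
  obtain x0 where x0: "x0 \<in> V F0 e0" "\<Psi> x0 < I (F0, e0) + \<eta> / 2"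
    using I_near[OF F0(1), of "\<eta> / 2"] \<eta>(1) by auto
  have "\<exists>x. \<bar>blinfun_apply f x - \<phi> f\<bar> < e \<and> norm (x0 - x) \<le> 2 * d / r" if e: "e > 0" for f e
  proof -
    have N: "(insert f F0, min e e0) \<in> \<N>" using F0(1) e by (simp add: \<N>_def)
    obtain x where x: "x \<in> V (insert f F0) (min e e0)" "\<Psi> x < I (insert f F0, min e e0) + \<eta> / 2"
      using I_near[OF N, of "\<eta> / 2"] \<eta>(1) by auto
    have xV: "x \<in> V F0 e0" using x(1) by (auto simp: V_def)
    \<comment> \<open>The midpoint stays in the convex set \<open>V F0 e0\<close>, so
      \<open>\<Psi> m\<close> exceeds \<open>S - \<eta> / 2\<close>, while both endpoint values are
      below \<open>S + \<eta> / 2\<close>; the midpoint gap is at most \<eta>.\<close>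
    define m where "m = (1/2) *\<^sub>R (x0 + x)"
    have "m \<in> V F0 e0"
      unfolding V_def
    proof (intro CollectI conjI ballI)
      show "norm m \<le> norm \<phi>"
        using x0(1) xV norm_triangle_ineq[of x0 x] by (simp add: m_def V_def)
      have "2 *\<^sub>R (T m - y) = (T x0 - y) + (T x - y)"
        by (simp add: m_def blinfun.scaleR_right blinfun.add_right scaleR_diff_right scaleR_2[of y])
      then have "2 * norm (T m - y) = norm ((T x0 - y) + (T x - y))"
        by (metis norm_scaleR abs_numeral)
      then show "norm (T m - y) < d"
        using x0(1) xV norm_triangle_ineq[of "T x0 - y" "T x - y"] by (simp add: V_def)
      fix h assume "h \<in> F0"
      then have "\<bar>blinfun_apply h x0 - \<phi> h\<bar> < e0" "\<bar>blinfun_apply h x - \<phi> h\<bar> < e0"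
        using x0(1) xV by (auto simp: V_def)
      moreover have "blinfun_apply h m - \<phi> h = ((blinfun_apply h x0 - \<phi> h) + (blinfun_apply h x - \<phi> h)) / 2"
        by (simp add: m_def blinfun.scaleR_right blinfun.add_right field_simps)
      ultimately show "\<bar>blinfun_apply h m - \<phi> h\<bar> < e0" by (simp add: abs_less_iff)
    qed
    then have "S - \<eta> / 2 < \<Psi> m" using I_le[of m F0 e0] F0(2) by simp
    moreover have "\<Psi> x0 < S + \<eta> / 2" and "\<Psi> x < S + \<eta> / 2"
      using x0(2) x(2) I_le_S[OF F0(1)] I_le_S[OF N] by linarith+
    ultimately have gap: "(\<Psi> x0 + \<Psi> x) / 2 - \<Psi> m \<le> \<eta>" by (simp add: field_simps)
    have \<Psi>m: "\<Psi> m = (\<integral>\<omega>. sqrt (1 + ((j x0 \<omega> + j x \<omega>) / 2)\<^sup>2) \<partial>M)"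
      unfolding \<Psi>_def
    proof (rule integral_cong_AE)
      show "AE \<omega> in M. sqrt (1 + (j m \<omega>)\<^sup>2) = sqrt (1 + ((j x0 \<omega> + j x \<omega>) / 2)\<^sup>2)"
        using j_scaleR[of "1/2" "x0 + x"] j_add[of x0 x]
      proof eventually_elim
        case (elim \<omega>)
        then have "j m \<omega> = (j x0 \<omega> + j x \<omega>) / 2" by (simp add: m_def)
        then show ?case by (simp only:)
      qed
    qed measurable
    have "L1_norm M (j z) \<le> K * norm \<phi>" if "z \<in> V F0 e0" for z
      using order.trans[OF K(2) mult_left_mono[of "norm z" "norm \<phi>"]] that K(1) by (simp add: V_def)
    then have "prob {\<omega> \<in> space M. \<bar>j x0 \<omega> - j x \<omega>\<bar> > \<tau>} < \<tau>"
      using gap[unfolded \<Psi>m, unfolded \<Psi>_def] x0(1) xV by (intro \<eta>(2)[OF j_integrable j_integrable])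
    also have "prob {\<omega> \<in> space M. \<bar>j x0 \<omega> - j x \<omega>\<bar> > \<tau>} = prob {\<omega> \<in> space M. \<bar>j (x0 - x) \<omega>\<bar> > \<tau>}"
    proof (rule finite_measure_eq_AE)
      show "AE \<omega> in M. \<omega> \<in> {\<omega> \<in> space M. \<bar>j x0 \<omega> - j x \<omega>\<bar> > \<tau>} \<longleftrightarrow> \<omega> \<in> {\<omega> \<in> space M. \<bar>j (x0 - x) \<omega>\<bar> > \<tau>}"
        using j_diff[of x0 x] by eventually_elim simp
    qed measurable
    finally have small: "prob {\<omega> \<in> space M. \<bar>j (x0 - x) \<omega>\<bar> > \<tau>} < \<tau>" .
    have "norm (x0 - x) \<le> 2 * d / r"
    proof (rule ccontr)
      assume big: "\<not> norm (x0 - x) \<le> 2 * d / r"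
      then have "\<tau> \<le> \<delta> * norm (x0 - x)"
        using \<tau>(3) \<delta> mult_left_mono[of "2 * d / r" "norm (x0 - x)" \<delta>] by (simp add: mult_ac)
      then have "prob {\<omega> \<in> space M. \<bar>j (x0 - x) \<omega>\<bar> > \<delta> * norm (x0 - x)} \<le> prob {\<omega> \<in> space M. \<bar>j (x0 - x) \<omega>\<bar> > \<tau>}"
        by (intro finite_measure_mono) auto
      then have "r * norm (x0 - x) \<le> norm (T (x0 - x))" using small \<tau>(2) by (intro below) linarith
      also have "T (x0 - x) = (T x0 - y) - (T x - y)" by (simp add: blinfun.diff_right)
      also have "norm \<dots> \<le> norm (T x0 - y) + norm (T x - y)" by (rule norm_triangle_ineq4)
      also have "\<dots> \<le> 2 * d" using x0(1) xV by (simp add: V_def)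
      finally show False using big r by (simp add: field_simps)
    qed
    then show ?thesis using x(1) by (intro exI[of _ x]) (simp add: V_def)
  qed
  note near = this
  \<comment> \<open>The point \<open>x0\<close> is fixed while \<open>x\<close> depends on
    \<open>f\<close> and \<open>e\<close>: \<open>f x\<close> approximates \<open>\<phi> f\<close>,
    and \<open>x\<close> is within \<open>2 * d / r\<close> of \<open>x0\<close>.\<close>
  have "norm (\<phi> - bidual_emb x0) \<le> 2 * d / r"
  proof (rule norm_blinfun_bound)
    show "0 \<le> 2 * d / r" using d0 r by simp
    fix f
    show "norm (blinfun_apply (\<phi> - bidual_emb x0) f) \<le> 2 * d / r * norm f"
    proof (rule field_le_epsilon)
      fix e :: real assume "e > 0"
      then obtain x where x: "\<bar>blinfun_apply f x - \<phi> f\<bar> < e" "norm (x0 - x) \<le> 2 * d / r"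
        using near by blast
      have "\<bar>blinfun_apply f (x0 - x)\<bar> \<le> norm f * norm (x0 - x)" using norm_blinfun[of f "x0 - x"] by simp
      also have "\<dots> \<le> norm f * (2 * d / r)" using x(2) by (rule mult_left_mono) simp
      finally have "\<bar>f x0 - f x\<bar> \<le> 2 * d / r * norm f" by (simp add: blinfun.diff_right mult.commute)
      then show "norm (blinfun_apply (\<phi> - bidual_emb x0) f) \<le> 2 * d / r * norm f + e"
        using x(1) unfolding blinfun.diff_left bidual_emb_apply real_norm_def by linarith
    qed
  qed
  then show ?thesis by blast
qed

text \<open>Letting \<open>d\<close> decrease to the distance of \<open>bidual_op T \<phi>\<close>
  from the canonical image gives the lower bound with constant \<open>r / 2\<close>.\<close>

lemma DNS_imp_Tco_isomorphism_into:
  fixes T :: "'a \<Rightarrow>\<^sub>L 'b::banach"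
  assumes "DNS T"
  shows "Tco_isomorphism_into T"
proof -
  obtain r \<delta> where r: "r > 0" "\<delta> > 0"
    and below: "\<And>x. prob {\<omega> \<in> space M. \<bar>j x \<omega>\<bar> > \<delta> * norm x} < \<delta> \<Longrightarrow> r * norm x \<le> norm (T x)"
    using DNS_bounded_below_near_zero_in_measure[OF assms] by blast
  have "r / 2 * infdist \<phi> (range bidual_emb) \<le> infdist (bidual_op T \<phi>) (range bidual_emb)" for \<phi>
  proof (rule field_le_epsilon)
    fix e :: real assume e: "e > 0"
    define d where "d = infdist (bidual_op T \<phi>) (range bidual_emb) + e"
    have "infdist (bidual_op T \<phi>) (range bidual_emb) < d" using e by (simp add: d_def)
    then obtain y where "dist (bidual_op T \<phi>) (bidual_emb y) < d"
      by (subst (asm) infdist_def) (auto simp: cINF_less_iff)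
    then obtain x where "norm (\<phi> - bidual_emb x) \<le> 2 * d / r"
      using bidual_element_near_lattice[OF r below] unfolding dist_norm by blast
    then have "infdist \<phi> (range bidual_emb) \<le> 2 * d / r"
      using infdist_le[OF rangeI[of bidual_emb x], of \<phi>] by (simp add: dist_norm)
    then show "r / 2 * infdist \<phi> (range bidual_emb) \<le> infdist (bidual_op T \<phi>) (range bidual_emb) + e"
      using r(1) by (simp add: d_def field_simps)
  qed
  then show ?thesis unfolding Tco_isomorphism_into_def using r(1) by (intro exI[of _ "r / 2"]) auto
qed

end

section \<open>The push-out operator\<close>

lemma L1_norm_add_le:
  assumes "integrable M f" "integrable M g"
  shows "L1_norm M (\<lambda>\<omega>. f \<omega> + g \<omega>) \<le> L1_norm M f + L1_norm M g"
proof -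
  have "L1_norm M (\<lambda>\<omega>. f \<omega> + g \<omega>) \<le> (\<integral>\<omega>. \<bar>f \<omega>\<bar> + \<bar>g \<omega>\<bar> \<partial>M)"
    unfolding L1_norm_def using assms by (intro integral_mono) auto
  also have "\<dots> = L1_norm M f + L1_norm M g" unfolding L1_norm_def using assms by simp
  finally show ?thesis .
qed

lemma L1_norm_cmult: "L1_norm M (\<lambda>\<omega>. c * f \<omega>) = \<bar>c\<bar> * L1_norm M f"
  by (simp add: L1_norm_def abs_mult)

lemma L1_closed_subspace_closed_span:
  assumes F: "\<And>n. integrable M (F n)"
  shows "L1_closed_subspace M (L1_closed_span M F)"
  unfolding L1_closed_subspace_def
proof (intro conjI ballI allI impI)
  have comb: "integrable M (\<lambda>\<omega>. \<Sum>i<n. c i * F i \<omega>)" for n c using F by auto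
  show "L1_closed_span M F \<subseteq> L1 M" by (auto simp: L1_closed_span_def)
  show "(\<lambda>_. 0) \<in> L1_closed_span M F"
    by (auto simp: L1_closed_span_def L1_def L1_norm_def intro!: exI[of _ 0])
  show "(\<lambda>\<omega>. f \<omega> + g \<omega>) \<in> L1_closed_span M F"
    if fg: "f \<in> L1_closed_span M F" "g \<in> L1_closed_span M F" for f g
  proof -
    have int: "integrable M f" "integrable M g" using fg by (auto simp: L1_closed_span_def L1_def)
    have "\<exists>n c. L1_norm M (\<lambda>\<omega>. f \<omega> + g \<omega> - (\<Sum>i<n. c i * F i \<omega>)) < e" if e: "e > 0" for e
    proof -
      obtain n c where c: "L1_norm M (\<lambda>\<omega>. f \<omega> - (\<Sum>i<n. c i * F i \<omega>)) < e / 2"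
        using fg(1) e by (auto simp: L1_closed_span_def dest!: spec[of _ "e / 2"])
      obtain m d where d: "L1_norm M (\<lambda>\<omega>. g \<omega> - (\<Sum>i<m. d i * F i \<omega>)) < e / 2"
        using fg(2) e by (auto simp: L1_closed_span_def dest!: spec[of _ "e / 2"])
      let ?N = "max n m"
      \<comment> \<open>Both coefficient sequences are padded with zeros to the common length
        \<open>?N\<close>.\<close>
      let ?b = "\<lambda>i. (if i < n then c i else 0) + (if i < m then d i else 0)"
      have ext: "(\<Sum>i<?N. (if i < k then b i else 0) * F i \<omega>) = (\<Sum>i<k. b i * F i \<omega>)" if "k \<le> ?N" for k b \<omega>
      proof -
        have "(\<Sum>i<?N. (if i < k then b i else 0) * F i \<omega>) = (\<Sum>i<k. (if i < k then b i else 0) * F i \<omega>)"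
          using that by (intro sum.mono_neutral_right) auto
        then show ?thesis by simp
      qed
      have "(\<Sum>i<?N. ?b i * F i \<omega>) = (\<Sum>i<n. c i * F i \<omega>) + (\<Sum>i<m. d i * F i \<omega>)" for \<omega>
        using ext[of n c \<omega>] ext[of m d \<omega>] by (simp add: distrib_right sum.distrib)
      then have "L1_norm M (\<lambda>\<omega>. f \<omega> + g \<omega> - (\<Sum>i<?N. ?b i * F i \<omega>))
          = L1_norm M (\<lambda>\<omega>. (f \<omega> - (\<Sum>i<n. c i * F i \<omega>)) + (g \<omega> - (\<Sum>i<m. d i * F i \<omega>)))"
        by (simp add: algebra_simps)
      also have "\<dots> \<le> L1_norm M (\<lambda>\<omega>. f \<omega> - (\<Sum>i<n. c i * F i \<omega>)) + L1_norm M (\<lambda>\<omega>. g \<omega> - (\<Sum>i<m. d i * F i \<omega>))"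
        using int comb by (intro L1_norm_add_le Bochner_Integration.integrable_diff)
      finally have "L1_norm M (\<lambda>\<omega>. f \<omega> + g \<omega> - (\<Sum>i<?N. ?b i * F i \<omega>)) < e" using c d by linarith
      then show ?thesis by (intro exI[of _ ?N] exI[of _ ?b])
    qed
    then show ?thesis using int by (simp add: L1_closed_span_def L1_def)
  qed
  show "(\<lambda>\<omega>. r * f \<omega>) \<in> L1_closed_span M F" if f: "f \<in> L1_closed_span M F" for r f
  proof -
    have int: "integrable M f" using f by (auto simp: L1_closed_span_def L1_def)
    have "\<exists>n c. L1_norm M (\<lambda>\<omega>. r * f \<omega> - (\<Sum>i<n. c i * F i \<omega>)) < e" if e: "e > 0" for e
    proof -
      have "e / (\<bar>r\<bar> + 1) > 0" using e by simp
      then obtain n c where c: "L1_norm M (\<lambda>\<omega>. f \<omega> - (\<Sum>i<n. c i * F i \<omega>)) < e / (\<bar>r\<bar> + 1)"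
        using f unfolding L1_closed_span_def by blast
      have "L1_norm M (\<lambda>\<omega>. r * f \<omega> - (\<Sum>i<n. (r * c i) * F i \<omega>))
          = L1_norm M (\<lambda>\<omega>. r * (f \<omega> - (\<Sum>i<n. c i * F i \<omega>)))"
        by (simp add: right_diff_distrib sum_distrib_left mult.assoc)
      also have "\<dots> = \<bar>r\<bar> * L1_norm M (\<lambda>\<omega>. f \<omega> - (\<Sum>i<n. c i * F i \<omega>))"
        by (rule L1_norm_cmult)
      also have "\<dots> \<le> \<bar>r\<bar> * (e / (\<bar>r\<bar> + 1))" using c by (intro mult_left_mono) auto
      also have "\<dots> < e" using e by (simp add: field_simps)
      finally show ?thesis by (intro exI[of _ n] exI[of _ "\<lambda>i. r * c i"])
    qed
    then show ?thesis using int by (simp add: L1_closed_span_def L1_def)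
  qed
  show "g \<in> L1_closed_span M F"
    if g: "g \<in> L1 M" "\<forall>e>0. \<exists>h\<in>L1_closed_span M F. L1_norm M (\<lambda>\<omega>. g \<omega> - h \<omega>) < e" for g
  proof -
    have int: "integrable M g" using g by (simp add: L1_def)
    have "\<exists>n c. L1_norm M (\<lambda>\<omega>. g \<omega> - (\<Sum>i<n. c i * F i \<omega>)) < e" if e: "e > 0" for e
    proof -
      have e2: "e / 2 > 0" using e by simp
      then obtain h where h: "h \<in> L1_closed_span M F" "L1_norm M (\<lambda>\<omega>. g \<omega> - h \<omega>) < e / 2"
        using g(2) by blast
      then obtain n c where c: "L1_norm M (\<lambda>\<omega>. h \<omega> - (\<Sum>i<n. c i * F i \<omega>)) < e / 2"
        using e2 unfolding L1_closed_span_def by blast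
      have inth: "integrable M h" using h by (auto simp: L1_closed_span_def L1_def)
      have "L1_norm M (\<lambda>\<omega>. (g \<omega> - h \<omega>) + (h \<omega> - (\<Sum>i<n. c i * F i \<omega>)))
          \<le> L1_norm M (\<lambda>\<omega>. g \<omega> - h \<omega>) + L1_norm M (\<lambda>\<omega>. h \<omega> - (\<Sum>i<n. c i * F i \<omega>))"
        using int inth comb by (intro L1_norm_add_le Bochner_Integration.integrable_diff)
      then have "L1_norm M (\<lambda>\<omega>. g \<omega> - (\<Sum>i<n. c i * F i \<omega>)) < e" using h(2) c by simp
      then show ?thesis by blast
    qed
    then show ?thesis using int by (simp add: L1_closed_span_def L1_def)
  qed
qed

text \<open>Off \<open>G\<close> the mass of a limit \<open>g\<close> is at most its distance to any
  function vanishing there. Restricting supports in this way takes the tail of a closed disjoint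
  span without using coefficients.\<close>

lemma L1_closed_subspace_supported_in:
  assumes W: "L1_closed_subspace M W" and G: "G \<in> sets M"
  shows "L1_closed_subspace M {g \<in> W. AE \<omega> in M. \<omega> \<in> G \<or> g \<omega> = 0}"
  unfolding L1_closed_subspace_def
proof (intro conjI ballI allI impI)
  let ?Z = "{g \<in> W. AE \<omega> in M. \<omega> \<in> G \<or> g \<omega> = 0}"
  show "?Z \<subseteq> L1 M" and "(\<lambda>_. 0) \<in> ?Z" using W by (auto simp: L1_closed_subspace_def)
  show "(\<lambda>\<omega>. f \<omega> + g \<omega>) \<in> ?Z" if "f \<in> ?Z" "g \<in> ?Z" for f g
  proof -
    have "AE \<omega> in M. \<omega> \<in> G \<or> f \<omega> = 0" "AE \<omega> in M. \<omega> \<in> G \<or> g \<omega> = 0" using that by auto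
    then have "AE \<omega> in M. \<omega> \<in> G \<or> f \<omega> + g \<omega> = 0" by eventually_elim auto
    then show ?thesis using that W by (auto simp: L1_closed_subspace_def)
  qed
  show "(\<lambda>\<omega>. r * f \<omega>) \<in> ?Z" if "f \<in> ?Z" for r f
  proof -
    have "AE \<omega> in M. \<omega> \<in> G \<or> f \<omega> = 0" using that by auto
    then have "AE \<omega> in M. \<omega> \<in> G \<or> r * f \<omega> = 0" by eventually_elim auto
    then show ?thesis using that W by (auto simp: L1_closed_subspace_def)
  qed
  show "g \<in> ?Z" if g: "g \<in> L1 M" "\<forall>e>0. \<exists>h\<in>?Z. L1_norm M (\<lambda>\<omega>. g \<omega> - h \<omega>) < e" for g
  proof -
    have "g \<in> W" using W g unfolding L1_closed_subspace_def by blast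
    have int: "integrable M g" using g(1) by (simp add: L1_def)
    have int': "integrable M (\<lambda>\<omega>. \<bar>g \<omega>\<bar> * indicator (space M - G) \<omega>)"
      using int G by (intro integrable_real_mult_indicator) auto
    have "(\<integral>\<omega>. \<bar>g \<omega>\<bar> * indicator (space M - G) \<omega> \<partial>M) \<le> 0"
    proof (rule field_le_epsilon)
      fix e :: real assume "e > 0"
      then obtain h where h: "h \<in> ?Z" "L1_norm M (\<lambda>\<omega>. g \<omega> - h \<omega>) < e" using g(2) by blast
      have inth: "integrable M h" using h(1) W by (auto simp: L1_closed_subspace_def L1_def)
      have AEh: "AE \<omega> in M. \<omega> \<in> G \<or> h \<omega> = 0" using h(1) by simp
      have "(\<integral>\<omega>. \<bar>g \<omega>\<bar> * indicator (space M - G) \<omega> \<partial>M) \<le> L1_norm M (\<lambda>\<omega>. g \<omega> - h \<omega>)"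
        unfolding L1_norm_def
      proof (rule integral_mono_AE[OF int'])
        show "integrable M (\<lambda>\<omega>. \<bar>g \<omega> - h \<omega>\<bar>)" using int inth by simp
        show "AE \<omega> in M. \<bar>g \<omega>\<bar> * indicator (space M - G) \<omega> \<le> \<bar>g \<omega> - h \<omega>\<bar>"
          using AEh by eventually_elim (auto simp: indicator_def)
      qed
      then show "(\<integral>\<omega>. \<bar>g \<omega>\<bar> * indicator (space M - G) \<omega> \<partial>M) \<le> 0 + e" using h(2) by simp
    qed
    moreover have "0 \<le> (\<integral>\<omega>. \<bar>g \<omega>\<bar> * indicator (space M - G) \<omega> \<partial>M)" by simp
    ultimately have "(\<integral>\<omega>. \<bar>g \<omega>\<bar> * indicator (space M - G) \<omega> \<partial>M) = 0" by linarith
    then have "AE \<omega> in M. \<bar>g \<omega>\<bar> * indicator (space M - G) \<omega> = 0"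
      using integral_nonneg_eq_0_iff_AE[OF int'] by simp
    then have "AE \<omega> in M. \<omega> \<in> G \<or> g \<omega> = 0"
      using AE_space by eventually_elim (auto simp: indicator_def split: if_splits)
    then show ?thesis using \<open>g \<in> W\<close> by simp
  qed
qed

context L1_represented_lattice
begin

text \<open>A small push-out norm of \<open>f\<close> yields \<open>x\<close> with
  \<open>T x\<close> small and \<open>j x\<close> close to \<open>f\<close> in L1. If
  \<open>f\<close> lives on a set of small measure, \<open>x\<close> is small in measure, so
  \<open>T\<close> must be bounded below at \<open>x\<close>.\<close>

lemma DNS_imp_L1_DNS_pushout:
  fixes T :: "'a \<Rightarrow>\<^sub>L 'b::banach"
  assumes T: "DNS T"
  shows "L1_DNS M (pushout_norm T j M)"
  unfolding L1_DNS_def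
proof (intro notI, elim exE conjE)
  fix F assume F: "\<forall>n. F n \<in> L1 M \<and> \<not> (AE \<omega> in M. F n \<omega> = 0)"
    and disj: "\<forall>n m. n \<noteq> m \<longrightarrow> (AE \<omega> in M. F n \<omega> = 0 \<or> F m \<omega> = 0)"
    and sing: "L1_strictly_singular_on M (pushout_norm T j M) (L1_closed_span M F)"
  have F_int: "integrable M (F n)" and F_nz: "\<not> (AE \<omega> in M. F n \<omega> = 0)" for n
    using F by (auto simp: L1_def)
  have [measurable]: "F n \<in> borel_measurable M" for n using F_int by (rule borel_measurable_integrable)
  have all_disj: "AE \<omega> in M. \<forall>n m. n \<noteq> m \<longrightarrow> F n \<omega> = 0 \<or> F m \<omega> = 0"
    unfolding AE_all_countable using disj by auto
  obtain r \<delta> where r: "r > 0" and \<delta>: "\<delta> > 0"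
    and below: "\<And>x. prob {\<omega> \<in> space M. \<bar>j x \<omega>\<bar> > \<delta> * norm x} < \<delta> \<Longrightarrow> r * norm x \<le> norm (T x)"
    using DNS_bounded_below_near_zero_in_measure[OF T] by blast
  obtain K where K: "K > 0" "\<And>x. L1_norm M (j x) \<le> K * norm x" using j_L1_bound by blast
  define G where "G N = (\<Union>i\<in>{N..}. {\<omega> \<in> space M. F i \<omega> \<noteq> 0})" for N :: nat
  have G [measurable]: "G N \<in> sets M" for N unfolding G_def by measurable
  have "(\<lambda>N. prob (G N)) \<longlonglongrightarrow> prob (\<Inter>N. G N)"
  proof (rule finite_Lim_measure_decseq)
    show "decseq G" unfolding decseq_def G_def by fastforce
  qed auto
  \<comment> \<open>A point in every tail union lies in the supports of two different functions,
    which disjointness permits only on a null set.\<close>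
  moreover have "prob (\<Inter>N. G N) = 0"
  proof -
    have "AE \<omega> in M. \<omega> \<notin> (\<Inter>N. G N)"
      using all_disj
    proof eventually_elim
      case (elim \<omega>)
      show ?case
      proof
        assume \<omega>: "\<omega> \<in> (\<Inter>N. G N)"
        then have "\<omega> \<in> G 0" by blast
        then obtain i where i: "F i \<omega> \<noteq> 0" by (auto simp: G_def)
        have "\<omega> \<in> G (Suc i)" using \<omega> by blast
        then obtain k where "k \<ge> Suc i" "F k \<omega> \<noteq> 0" by (auto simp: G_def)
        then show False using elim[rule_format, of k i] i by simp
      qed
    qed
    then show ?thesis by (subst prob_eq_0) auto
  qed
  ultimately have "eventually (\<lambda>N. prob (G N) < \<delta> / 2) sequentially"
    using \<delta> by (intro order_tendstoD(2)) auto
  then obtain N where N: "prob (G N) < \<delta> / 2" by (auto simp: eventually_sequentially)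
  \<comment> \<open>The bound \<open>1/2\<close> gives
    \<open>L1_norm M f \<le> 2 * (K * norm x)\<close>; the second bound contradicts the lower
    estimate for \<open>T\<close>; the third makes the Markov term at most
    \<open>\<delta> / 4\<close>.\<close>
  define c where "c = min (1/2) (min (r / (4 * K)) (\<delta> * \<delta> / (8 * K)))"
  have "c \<le> r / (4 * K)" "c \<le> \<delta> * \<delta> / (8 * K)" unfolding c_def by linarith+
  then have c: "0 < c" "c \<le> 1/2" "2 * c * K \<le> r / 2" "2 * c * K \<le> \<delta> * \<delta> / 4"
    using r \<delta> K(1) by (auto simp: c_def field_simps)
  \<comment> \<open>\<open>Z\<close> contains every \<open>F (N + i)\<close>, and its members vanish
    off a set of probability below \<open>\<delta> / 2\<close>.\<close>
  define Z where "Z = {g \<in> L1_closed_span M F. AE \<omega> in M. \<omega> \<in> G N \<or> g \<omega> = 0}"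
  have "L1_closed_subspace M Z"
    unfolding Z_def by (intro L1_closed_subspace_supported_in L1_closed_subspace_closed_span F_int G)
  moreover have "Z \<subseteq> L1_closed_span M F" by (auto simp: Z_def)
  moreover have "L1_infinite_dim M Z"
    unfolding L1_infinite_dim_def
  proof (intro allI)
    fix n :: nat
    have "F (N + i) \<in> Z" for i
    proof -
      have "\<exists>n a. L1_norm M (\<lambda>\<omega>. F (N + i) \<omega> - (\<Sum>k<n. a k * F k \<omega>)) < e" if "e > 0" for e
      proof -
        have "(\<Sum>k<Suc (N + i). (if k = N + i then 1 else 0) * F k \<omega>) = F (N + i) \<omega>" for \<omega>
          by (simp add: if_distrib[of "\<lambda>t. t * _"] cong: if_cong)
        then have "L1_norm M (\<lambda>\<omega>. F (N + i) \<omega> - (\<Sum>k<Suc (N + i). (if k = N + i then 1 else 0) * F k \<omega>)) < e"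
          using that by (simp only: diff_self L1_norm_def abs_zero integral_zero)
        then show ?thesis
          by (intro exI[of _ "Suc (N + i)"] exI[of _ "\<lambda>k. if k = N + i then 1 else 0"])
      qed
      moreover have "AE \<omega> in M. \<omega> \<in> G N \<or> F (N + i) \<omega> = 0"
        by (rule AE_I2) (auto simp: G_def)
      ultimately show ?thesis using F_int by (simp add: Z_def L1_closed_span_def L1_def)
    qed
    moreover have "a i = 0" if zero: "AE \<omega> in M. (\<Sum>i<n. a i * F (N + i) \<omega>) = 0" and i: "i < n" for a i
    proof (rule ccontr)
      assume a: "a i \<noteq> 0"
      have "AE \<omega> in M. F (N + i) \<omega> = 0"
        using zero all_disj
      proof eventually_elim
        case (elim \<omega>)
        show ?case
        proof (rule ccontr)
          assume nz: "F (N + i) \<omega> \<noteq> 0"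
          have "(\<Sum>k<n. a k * F (N + k) \<omega>) = (\<Sum>k<n. if k = i then a k * F (N + k) \<omega> else 0)"
          proof (rule sum.cong[OF refl])
            fix k
            have "F (N + k) \<omega> = 0" if "k \<noteq> i"
              using elim(2)[rule_format, of "N + k" "N + i"] that nz by simp
            then show "a k * F (N + k) \<omega> = (if k = i then a k * F (N + k) \<omega> else 0)" by simp
          qed
          then show False using elim(1) i a nz by simp
        qed
      qed
      then show False using F_nz by blast
    qed
    ultimately show "\<exists>F. (\<forall>i<n. F i \<in> Z) \<and> (\<forall>c. (AE \<omega> in M. (\<Sum>i<n. c i * F i \<omega>) = 0) \<longrightarrow> (\<forall>i<n. c i = 0))"
      by (intro exI[of _ "\<lambda>i. F (N + i)"]) blast
  qed
  ultimately have "\<not> (\<exists>c>0. \<forall>f\<in>Z. c * L1_norm M f \<le> pushout_norm T j M f)"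
    using sing unfolding L1_strictly_singular_on_def by blast
  then obtain f where f: "f \<in> Z" "pushout_norm T j M f < c * L1_norm M f"
    using c(1) by (meson not_le)
  have f_int: "integrable M f" using f(1) by (simp add: Z_def L1_closed_span_def L1_def)
  have [measurable]: "f \<in> borel_measurable M" using f_int by simp
  have "bdd_below (range (\<lambda>x. norm (T x) + L1_norm M (\<lambda>\<omega>. f \<omega> - j x \<omega>)))"
    by (rule bdd_belowI2[of _ 0]) (simp add: L1_norm_nonneg)
  then obtain x where x: "norm (T x) + L1_norm M (\<lambda>\<omega>. f \<omega> - j x \<omega>) < c * L1_norm M f"
    using f(2) unfolding pushout_norm_def by (subst (asm) cINF_less_iff) auto
  define m where "m = L1_norm M f"
  have m: "0 \<le> m" unfolding m_def by (rule L1_norm_nonneg)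
  have x1: "norm (T x) < c * m" "L1_norm M (\<lambda>\<omega>. f \<omega> - j x \<omega>) < c * m"
    using x L1_norm_nonneg[of M "\<lambda>\<omega>. f \<omega> - j x \<omega>"] norm_ge_zero[of "T x"] unfolding m_def by linarith+
  have "m \<le> L1_norm M (\<lambda>\<omega>. f \<omega> - j x \<omega>) + L1_norm M (j x)"
    using L1_norm_add_le[of M "\<lambda>\<omega>. f \<omega> - j x \<omega>" "j x"] f_int by (simp add: m_def)
  moreover have "c * m \<le> 1/2 * m" using c(2) m by (rule mult_right_mono)
  ultimately have "m \<le> 2 * (K * norm x)" using x1(2) K(2)[of x] by linarith
  then have cm: "c * m \<le> 2 * c * K * norm x" using mult_left_mono[of m "2 * (K * norm x)" c] c(1) by simp
  have xpos: "0 < norm x"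
  proof (rule ccontr)
    assume "\<not> 0 < norm x"
    then have "x = 0" by simp
    then show False using cm x1(1) by simp
  qed
  have "prob {\<omega> \<in> space M. \<bar>j x \<omega>\<bar> > \<delta> * norm x}
      \<le> prob (G N \<union> {\<omega> \<in> space M. \<bar>f \<omega> - j x \<omega>\<bar> > \<delta> * norm x})"
  proof (rule finite_measure_mono_AE)
    have "AE \<omega> in M. \<omega> \<in> G N \<or> f \<omega> = 0" using f(1) by (simp add: Z_def)
    then show "AE \<omega> in M. \<omega> \<in> {\<omega> \<in> space M. \<bar>j x \<omega>\<bar> > \<delta> * norm x} \<longrightarrow>
        \<omega> \<in> G N \<union> {\<omega> \<in> space M. \<bar>f \<omega> - j x \<omega>\<bar> > \<delta> * norm x}"
      by eventually_elim auto
  qed measurable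
  also have "\<dots> \<le> prob (G N) + prob {\<omega> \<in> space M. \<bar>f \<omega> - j x \<omega>\<bar> > \<delta> * norm x}"
    by (rule measure_Un_le) measurable
  also have "prob {\<omega> \<in> space M. \<bar>f \<omega> - j x \<omega>\<bar> > \<delta> * norm x} \<le> L1_norm M (\<lambda>\<omega>. f \<omega> - j x \<omega>) / (\<delta> * norm x)"
    by (rule prob_abs_gt_le) (use f_int \<delta> xpos in auto)
  also have "\<dots> \<le> \<delta> / 4"
  proof -
    have "2 * c * K * norm x \<le> \<delta> * \<delta> / 4 * norm x" using c(4) by (rule mult_right_mono) simp
    then have "L1_norm M (\<lambda>\<omega>. f \<omega> - j x \<omega>) \<le> \<delta> / 4 * (\<delta> * norm x)" using x1(2) cm by simp
    then show ?thesis using pos_divide_le_eq[of "\<delta> * norm x"] \<delta> xpos by simp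
  qed
  finally have "prob {\<omega> \<in> space M. \<bar>j x \<omega>\<bar> > \<delta> * norm x} < \<delta>" using N \<delta> by simp
  then have "r * norm x \<le> norm (T x)" by (rule below)
  moreover have "2 * c * K * norm x \<le> r / 2 * norm x" using c(3) by (rule mult_right_mono) simp
  moreover have "0 < r * norm x" using r xpos by simp
  ultimately show False using x1(1) cm by simp
qed

end

theorem theorem4p4:
  fixes T :: "'a::{banach,ordered_real_vector,lattice} \<Rightarrow>\<^sub>L 'b::banach"
    and M :: "'w measure" and j :: "'a \<Rightarrow> 'w \<Rightarrow> real"
  assumes "banach_lattice TYPE('a)"
    and "order_continuous TYPE('a)"
    and "\<exists>e::'a. weak_unit e"
    and "L1_representation M j"
    and "DNS T"
  shows "L1_DNS M (pushout_norm T j M)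
         \<and> tauberian T
         \<and> (tauberian (bidual_op T) \<and> Tco_isomorphism_into T)"
proof -
  interpret L1_represented_lattice M j using assms by unfold_locales
  \<comment> \<open>The lower bound for \<open>T^co\<close> also yields both tauberian statements by
    duality.\<close>
  have "Tco_isomorphism_into T" using \<open>DNS T\<close> by (rule DNS_imp_Tco_isomorphism_into)
  then show ?thesis
    using DNS_imp_L1_DNS_pushout[OF \<open>DNS T\<close>] Tco_isomorphism_into_imp_tauberian
      Tco_isomorphism_into_imp_tauberian_bidual by blast
qed

end
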